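(* Let $d\ge 1$, let $H=(H_1,\dots,H_d)\in(0,1)^d$, put $\bar H=\frac{H_1+\cdots+H_d}{d}$, and let $W^H$ be a fractional Brownian sheet on $[0,1]^d$ of Hurst multiparameter $H$, with all sample paths in $C_0([0,1]^d)$. If $\bar H>\frac{d-1}{d}$, then almost surely the sample path of $W^H$ is $\gamma$-Hölder strongly chargeable for every $0<\gamma<\bar H$.
   Context: A fractional Brownian sheet of Hurst multiparameter $H=(H_1,\dots,H_d)\in(0,1)^d$ is a centered Gaussian process $\{W^H_{t_1,\dots,t_d}:(t_1,\dots,t_d)\in[0,1]^d\}$ with covariance $\mathbb{E}(W^H_{t_1,\dots,t_d}W^H_{t'_1,\dots,t'_d})=\prod_{i=1}^d\frac{t_i^{2H_i}+t_i'^{2H_i}-|t_i-t'_i|^{2H_i}}{2}$. It has a continuous modification, and sample paths are taken in $C_0([0,1]^d)$, the space of continuous real functions on $[0,1]^d$ that vanish at every point having at least one zero coordinate. Increments: for $f\in C_0([0,1]^d)$ and a rectangle $K=\prod_{i=1}^d[a_i,b_i]\subseteq[0,1]^d$ (with $a_i<b_i$), $\Delta_f(K)=\sum_{(c_i)\in\prod_i\{a_i,b_i\}}(-1)^{\#\{i:\,c_i=a_i\}}f(c_1,\dots,c_d)$. A figure is a finite union of rectangles contained in $[0,1]^d$; $\Delta_f$ extends uniquely to a function on figures that is additive on almost disjoint figures (i.e. figures whose intersection is Lebesgue negligible). $BV([0,1]^d)$ is the space of $u\in BV(\mathbb{R}^d)$ that vanish a.e. outside $[0,1]^d$, with norm $\|u\|_{BV}=\|u\|_1+\|Du\|(\mathbb{R}^d)$,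 where $\|Du\|$ is the total variation measure of the distributional gradient $Du$. For $f\in L^d([0,1]^d)$, $T_f\in BV([0,1]^d)^*$ is $T_f(u)=\int_{[0,1]^d}fu$. $SCH([0,1]^d)$ is the closure of $\{T_f: f\in L^d([0,1]^d)\}$ in $BV([0,1]^d)^*$ (operator norm). A $BV$-subset of $[0,1]^d$ is a measurable $B\subseteq[0,1]^d$ with finite perimeter $\|B\|=\|D\mathbf{1}_B\|(\mathbb{R}^d)<\infty$. A strong charge is a function $\mu$ on the $BV$-subsets of $[0,1]^d$ of the form $\mu(B)=\alpha(\mathbf{1}_B)$ with $\alpha\in SCH([0,1]^d)$. A dyadic cube is a set $\prod_{i=1}^d[2^{-n}k_i,2^{-n}(k_i+1)]$ with integers $n\ge0$, $0\le k_i\le 2^n-1$. A strong charge $\mu$ is $\gamma$-Hölder if there is $C\ge0$ with $|\mu(K)|\le C|K|^\gamma$ for all dyadic cubes $K$, where $|K|$ is Lebesgue measure. A function $f\in C_0([0,1]^d)$ is $\gamma$-Hölder strongly chargeable if $\Delta_f$ (defined on figures) extends to a strong charge that is $\gamma$-Hölder. *)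

theory Defs
  imports "HOL-Probability.Probability"
begin

section \<open>Gaussian processes and the fractional Brownian sheet\<close>

text \<open>Constants count as (degenerate) Gaussian variables; the sheet vanishes on the coordinate
  hyperplanes.\<close>

definition gaussian_rv :: "'w measure \<Rightarrow> ('w \<Rightarrow> real) \<Rightarrow> bool" where
  "gaussian_rv M X \<longleftrightarrow> X \<in> borel_measurable M \<and>
     ((\<exists>m. AE \<omega> in M. X \<omega> = m) \<or>
      (\<exists>m \<sigma>. \<sigma> > 0 \<and> distributed M lborel X (normal_density m \<sigma>)))"

definition gaussian_process :: "'w measure \<Rightarrow> 't set \<Rightarrow> ('t \<Rightarrow> 'w \<Rightarrow> real) \<Rightarrow> bool" where
  "gaussian_process M T W \<longleftrightarrow>
     (\<forall>S c. finite S \<and> S \<subseteq> T \<longrightarrow> gaussian_rv M (\<lambda>\<omega>. \<Sum>t\<in>S. c t * W t \<omega>))"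

abbreviation unit_cube :: "(real^'n) set" where
  "unit_cube \<equiv> cbox 0 1"

definition fbs_covariance :: "real^'n \<Rightarrow> real^'n \<Rightarrow> real^'n \<Rightarrow> real" where
  "fbs_covariance H s t =
     (\<Prod>i\<in>UNIV. (s$i powr (2 * H$i) + t$i powr (2 * H$i) - \<bar>s$i - t$i\<bar> powr (2 * H$i)) / 2)"

definition fractional_brownian_sheet ::
    "'w measure \<Rightarrow> real^'n \<Rightarrow> (real^'n \<Rightarrow> 'w \<Rightarrow> real) \<Rightarrow> bool" where
  "fractional_brownian_sheet M H W \<longleftrightarrow>
     gaussian_process M unit_cube W \<and>
     (\<forall>t\<in>unit_cube. integral\<^sup>L M (W t) = 0) \<and>
     (\<forall>s\<in>unit_cube. \<forall>t\<in>unit_cube. integral\<^sup>L M (\<lambda>\<omega>. W s \<omega> * W t \<omega>) = fbs_covariance H s t)"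

text \<open>Elements of \<open>C0_cube\<close> are total functions; their values off the cube are irrelevant.\<close>

definition C0_cube :: "(real^'n \<Rightarrow> real) set" where
  "C0_cube = {f. continuous_on unit_cube f \<and> (\<forall>x\<in>unit_cube. (\<exists>i. x$i = 0) \<longrightarrow> f x = 0)}"


section \<open>Increments over rectangles and figures\<close>

definition rectangle_increment :: "(real^'n \<Rightarrow> real) \<Rightarrow> real^'n \<Rightarrow> real^'n \<Rightarrow> real" where
  "rectangle_increment f a b =
     (\<Sum>c | \<forall>i. c$i \<in> {a$i, b$i}. (-1) ^ card {i. c$i = a$i} * f c)"

definition rectangle :: "(real^'n) set \<Rightarrow> bool" where
  "rectangle K \<longleftrightarrow> (\<exists>a b. (\<forall>i. a$i < b$i) \<and> K = cbox a b \<and> K \<subseteq> unit_cube)"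

definition figure :: "(real^'n) set \<Rightarrow> bool" where
  "figure F \<longleftrightarrow> (\<exists>\<K>. finite \<K> \<and> (\<forall>K\<in>\<K>. rectangle K) \<and> F = \<Union>\<K>)"

definition additive_extension :: "(real^'n \<Rightarrow> real) \<Rightarrow> ((real^'n) set \<Rightarrow> real) \<Rightarrow> bool" where
  "additive_extension f \<nu> \<longleftrightarrow>
     (\<forall>a b. (\<forall>i. a$i < b$i) \<and> cbox a b \<subseteq> unit_cube \<longrightarrow> \<nu> (cbox a b) = rectangle_increment f a b) \<and>
     (\<forall>F G. figure F \<and> figure G \<and> negligible (F \<inter> G) \<longrightarrow> \<nu> (F \<union> G) = \<nu> F + \<nu> G)"

text \<open>The values of an additive extension are uniquely determined on figures; only these are ever
  used.\<close>

definition figure_increment :: "(real^'n \<Rightarrow> real) \<Rightarrow> (real^'n) set \<Rightarrow> real" where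
  "figure_increment f = (SOME \<nu>. additive_extension f \<nu>)"


section \<open>Functions of bounded variation\<close>

definition partial_deriv :: "'n \<Rightarrow> (real^'n \<Rightarrow> real) \<Rightarrow> real^'n \<Rightarrow> real" where
  "partial_deriv i \<phi> x = frechet_derivative \<phi> (at x) (axis i 1)"

primrec C_k :: "nat \<Rightarrow> (real^'n \<Rightarrow> real) \<Rightarrow> bool" where
  "C_k 0 \<phi> \<longleftrightarrow> continuous_on UNIV \<phi>"
| "C_k (Suc k) \<phi> \<longleftrightarrow> \<phi> differentiable_on UNIV \<and> (\<forall>i. C_k k (partial_deriv i \<phi>))"

definition test_function :: "(real^'n \<Rightarrow> real) \<Rightarrow> bool" where
  "test_function \<phi> \<longleftrightarrow> (\<forall>k. C_k k \<phi>) \<and> compact (closure {x. \<phi> x \<noteq> 0})"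

text \<open>\<open>distr_gradient u \<nu>\<close>: the distributional gradient of \<open>u\<close> is the \<open>\<real>\<^sup>d\<close>-valued Borel measure
  \<open>\<nu>\<close>. The components of \<open>\<nu>\<close> are finite signed measures, that is, differences \<open>P i - N i\<close> of
  finite measures, and integration against them is
  \<open>\<integral>\<phi> d\<nu>\<^sub>i = \<integral>\<phi> d(P i) - \<integral>\<phi> d(N i)\<close>, which does not depend on the choice of \<open>P\<close> and \<open>N\<close>.\<close>

definition distr_gradient :: "(real^'n \<Rightarrow> real) \<Rightarrow> ((real^'n) set \<Rightarrow> real^'n) \<Rightarrow> bool" where
  "distr_gradient u \<nu> \<longleftrightarrow>
     (\<exists>P N :: 'n \<Rightarrow> (real^'n) measure.
        (\<forall>i. finite_measure (P i) \<and> sets (P i) = sets borel \<and>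
             finite_measure (N i) \<and> sets (N i) = sets borel) \<and>
        (\<forall>i. \<forall>A\<in>sets borel. \<nu> A $ i = measure (P i) A - measure (N i) A) \<and>
        (\<forall>\<phi> i. test_function \<phi> \<longrightarrow>
           (\<integral>x. u x * partial_deriv i \<phi> x \<partial>lebesgue)
             = - ((\<integral>x. \<phi> x \<partial>(P i)) - (\<integral>x. \<phi> x \<partial>(N i)))))"

definition total_variation :: "((real^'n) set \<Rightarrow> real^'n) \<Rightarrow> (real^'n) set \<Rightarrow> ennreal" where
  "total_variation \<nu> A =
     (SUP E \<in> {E :: nat \<Rightarrow> (real^'n) set.
                 range E \<subseteq> sets borel \<and> disjoint_family E \<and> (\<Union>k. E k) = A}.
        \<Sum>k. ennreal (norm (\<nu> (E k))))"

text \<open>The total mass \<open>\<parallel>Du\<parallel>(\<real>\<^sup>d)\<close>, infinite if \<open>Du\<close> is not a measure. The gradient measure is unique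
  on Borel sets for locally integrable \<open>u\<close>.\<close>

definition gradient_variation :: "(real^'n \<Rightarrow> real) \<Rightarrow> ennreal" where
  "gradient_variation u =
     (if \<exists>\<nu>. distr_gradient u \<nu> then total_variation (SOME \<nu>. distr_gradient u \<nu>) UNIV else \<infinity>)"

definition BV_cube :: "(real^'n \<Rightarrow> real) set" where
  "BV_cube = {u. integrable lebesgue u \<and> gradient_variation u < \<infinity> \<and>
                 (AE x in lebesgue. x \<notin> unit_cube \<longrightarrow> u x = 0)}"

definition BV_norm :: "(real^'n \<Rightarrow> real) \<Rightarrow> real" where
  "BV_norm u = (\<integral>x. \<bar>u x\<bar> \<partial>lebesgue) + enn2real (gradient_variation u)"


section \<open>Strong charges\<close>

text \<open>Elements of the dual act on functions rather than on almost-everywhere classes; boundedness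
  makes them respect almost-everywhere equality.\<close>

definition BV_dual :: "((real^'n \<Rightarrow> real) \<Rightarrow> real) set" where
  "BV_dual = {\<alpha>.
     (\<forall>u\<in>BV_cube. \<forall>v\<in>BV_cube. \<alpha> (\<lambda>x. u x + v x) = \<alpha> u + \<alpha> v) \<and>
     (\<forall>c. \<forall>u\<in>BV_cube. \<alpha> (\<lambda>x. c * u x) = c * \<alpha> u) \<and>
     (\<exists>C. \<forall>u\<in>BV_cube. \<bar>\<alpha> u\<bar> \<le> C * BV_norm u)}"

definition Ld_cube :: "(real^'n \<Rightarrow> real) set" where
  "Ld_cube = {f. set_borel_measurable lebesgue unit_cube f \<and>
                 set_integrable lebesgue unit_cube (\<lambda>x. \<bar>f x\<bar> ^ CARD('n))}"

definition T_functional :: "(real^'n \<Rightarrow> real) \<Rightarrow> (real^'n \<Rightarrow> real) \<Rightarrow> real" where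
  "T_functional f u = set_lebesgue_integral lebesgue unit_cube (\<lambda>x. f x * u x)"

text \<open>The closure of the functionals \<open>T\<^sub>f\<close> in the operator norm: the last inequality says that the
  operator norm of \<open>\<alpha> - T\<^sub>f\<close> is at most \<open>\<epsilon>\<close>.\<close>

definition SCH :: "((real^'n \<Rightarrow> real) \<Rightarrow> real) set" where
  "SCH = {\<alpha> \<in> BV_dual. \<forall>\<epsilon>>0. \<exists>f\<in>Ld_cube. \<forall>u\<in>BV_cube. \<bar>\<alpha> u - T_functional f u\<bar> \<le> \<epsilon> * BV_norm u}"

definition BV_subset :: "(real^'n) set \<Rightarrow> bool" where
  "BV_subset B \<longleftrightarrow> B \<in> sets lebesgue \<and> B \<subseteq> unit_cube \<and> gradient_variation (indicator B) < \<infinity>"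

text \<open>Set functions are total; a strong charge is only constrained on BV-subsets.\<close>

definition strong_charge :: "((real^'n) set \<Rightarrow> real) \<Rightarrow> bool" where
  "strong_charge \<mu> \<longleftrightarrow> (\<exists>\<alpha>\<in>SCH. \<forall>B. BV_subset B \<longrightarrow> \<mu> B = \<alpha> (indicator B))"

definition dyadic_cube :: "(real^'n) set \<Rightarrow> bool" where
  "dyadic_cube K \<longleftrightarrow> (\<exists>(n::nat) (k :: 'n \<Rightarrow> nat). (\<forall>i. k i < 2 ^ n) \<and>
     K = cbox (\<chi> i. real (k i) / 2 ^ n) (\<chi> i. (real (k i) + 1) / 2 ^ n))"

definition holder_charge :: "real \<Rightarrow> ((real^'n) set \<Rightarrow> real) \<Rightarrow> bool" where
  "holder_charge \<gamma> \<mu> \<longleftrightarrow>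
     (\<exists>C\<ge>0. \<forall>K. dyadic_cube K \<longrightarrow> \<bar>\<mu> K\<bar> \<le> C * measure lebesgue K powr \<gamma>)"

definition holder_strongly_chargeable :: "real \<Rightarrow> (real^'n \<Rightarrow> real) \<Rightarrow> bool" where
  "holder_strongly_chargeable \<gamma> f \<longleftrightarrow> f \<in> C0_cube \<and>
     (\<exists>\<mu>. strong_charge \<mu> \<and> (\<forall>F. figure F \<longrightarrow> \<mu> F = figure_increment f F) \<and> holder_charge \<gamma> \<mu>)"

end

theory Submission
  imports Defs
begin

text \<open>Write \<open>d\<close> for the dimension, \<open>h\<close> for the mean of the Hurst parameters and \<open>\<Delta>(K)\<close> for the
  increment of a function over the box \<open>K\<close>.

  The covariance is a product over the coordinates, so the increment of the sheet over a box with
  side lengths \<open>l\<^sub>i\<close> is a centred Gaussian variable with variance \<open>\<Prod>\<^sub>i l\<^sub>i powr (2 H\<^sub>i)\<close>; for a dyadic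
  cube this is \<open>|K| powr (2 h)\<close>. High moments and the Borel-Cantelli lemma then give, for each
  \<open>\<gamma> < h\<close>, almost surely a bound \<open>|\<Delta>(K)| \<le> C |K| powr \<gamma>\<close> over all dyadic cubes
  (\<open>AE_dyadic_increment_bound\<close>). What remains is deterministic (\<open>holder_strongly_chargeableI\<close>): for
  continuous \<open>f\<close> such a bound with \<open>\<gamma> > (d - 1) / d\<close> makes \<open>f\<close> strongly chargeable.

  Let \<open>g\<^sub>n\<close> take the constant value \<open>\<Delta>(K) / |K|\<close> on each dyadic cube \<open>K\<close> of side \<open>2\<^sup>-\<^sup>n\<close>. The sought
  charge is the limit of the functionals \<open>T g\<^sub>n\<close>, and the point is their convergence in the dual norm.
  Pass from \<open>g\<^sub>n\<close> to \<open>g\<^sub>n\<^sub>+\<^sub>1\<close> by halving the cells in one coordinate direction \<open>i\<close> after the other. By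
  additivity of \<open>\<Delta>\<close>, each such change is a Haar function: opposite constants on the two halves of
  every cell. It is therefore the \<open>i\<close>-th partial derivative of a function \<open>\<phi>\<close> that is a tent in the
  direction \<open>i\<close>, with \<open>|\<phi>| \<le> const \<cdot> 2\<^sup>-\<^sup>n \<cdot> sup |g\<^sub>n\<^sub>+\<^sub>1 - g\<^sub>n|\<close>. Integration by parts against \<open>u \<in> BV\<close> gives
  (\<open>cell_density_refine_bound\<close>, \<open>T_Suc_diff\<close>)
  \<open>|T g\<^sub>n\<^sub>+\<^sub>1 u - T g\<^sub>n u| \<le> const \<cdot> \<parallel>Du\<parallel> \<cdot> r\<^sup>n\<close> with \<open>r = 2 powr (d - 1 - d \<gamma>) < 1\<close>. The tents
  over different cells have disjoint supports and make up a single test function, so the variation of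
  \<open>u\<close> enters once and not once per cell. As \<open>\<phi>\<close> is not smooth, it is replaced by bounded smooth approximations
  made from \<open>exp (-1/x)\<close>, whose derivatives converge boundedly.

  On the indicator of a box with corners on the grid, \<open>T g\<^sub>n\<close> is exactly \<open>\<Delta>\<close>, by telescoping. Rounding
  the corners of an arbitrary box to the grid moves a volume of order \<open>2\<^sup>-\<^sup>n\<close>, which changes the integral
  of \<open>g\<^sub>n\<close> by \<open>O(r\<^sup>n)\<close> only, so the limit functional extends \<open>\<Delta>\<close> from boxes to figures
  (\<open>T_indicator_tendsto_increment\<close>, \<open>limit_functional_additive_extension\<close>); additive extensions are
  unique on figures because a figure is an almost disjoint union of boxes.\<close>

section \<open>Increments over boxes and grid cells\<close>

definition corner :: "real^'n \<Rightarrow> real^'n \<Rightarrow> 'n set \<Rightarrow> real^'n" where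
  "corner a b S = (\<chi> i. if i \<in> S then a$i else b$i)"

text \<open>The increment over \<open>cbox a b\<close>, indexed by the set of coordinates in which a vertex takes its lower
  value. Unlike the sum over vertices this stays meaningful, with value 0, when a side degenerates,
  which happens when corners are rounded to a grid.\<close>

definition box_increment :: "(real^'n \<Rightarrow> real) \<Rightarrow> real^'n \<Rightarrow> real^'n \<Rightarrow> real" where
  "box_increment f a b = (\<Sum>S\<in>UNIV. (-1) ^ card S * f (corner a b S))"

lemma corner_nth [simp]: "corner a b S $ i = (if i \<in> S then a$i else b$i)"
  by (simp add: corner_def)

lemma inj_corner:
  assumes "\<And>i. a$i < b$i"
  shows "inj (corner a b)"
proof (rule injI)
  fix S T assume eq: "corner a b S = corner a b T"
  have "i \<in> S \<longleftrightarrow> i \<in> T" for i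
    using arg_cong[OF eq, of "\<lambda>x. x $ i"] assms[of i] by (auto split: if_splits)
  then show "S = T" by blast
qed

lemma vertices_eq_corners: "{c. \<forall>i. c$i \<in> {a$i, b$i}} = range (corner a b)"
proof safe
  fix c :: "real^'a" assume c: "\<forall>i. c$i \<in> {a$i, b$i}"
  have "c = corner a b {i. c$i = a$i}"
    using c by (auto simp: vec_eq_iff)
  then show "c \<in> range (corner a b)" by blast
qed auto

lemma corner_card:
  assumes "\<And>i. a$i < b$i"
  shows "card {i. corner a b S $ i = a$i} = card S"
proof -
  have "b$i \<noteq> a$i" for i using assms[of i] by simp
  then have "{i. corner a b S $ i = a$i} = S" by auto
  then show ?thesis by simp
qed

lemma rectangle_increment_eq_box_increment:
  assumes "\<And>i. a$i < b$i"
  shows "rectangle_increment f a b = box_increment f a b"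
  unfolding rectangle_increment_def box_increment_def vertices_eq_corners
  by (simp add: sum.reindex[OF inj_corner[OF assms]] corner_card[OF assms] del: corner_nth)

lemma box_increment_cong:
  assumes "\<And>S. f (corner a b S) = g (corner a b S)"
  shows "box_increment f a b = box_increment g a b"
  unfolding box_increment_def using assms by simp

lemma box_increment_sum: "box_increment (\<lambda>x. \<Sum>y\<in>Y. h y * g y x) a b = (\<Sum>y\<in>Y. h y * box_increment (g y) a b)"
  unfolding box_increment_def sum_distrib_left
  by (subst sum.swap) (simp add: sum_distrib_left mult.left_commute)

text \<open>For product functions the alternating sum factorises. This is what turns the product covariance
  into a product of one-dimensional variances, and what makes sums over grid cells telescope.\<close>

lemma box_increment_prod:
  fixes g :: "'n::finite \<Rightarrow> real \<Rightarrow> real"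
  shows "box_increment (\<lambda>x. \<Prod>i\<in>UNIV. g i (x$i)) a b = (\<Prod>i\<in>UNIV. g i (b$i) - g i (a$i))"
proof -
  have "(\<Prod>i\<in>UNIV. g i (b$i) - g i (a$i)) = (\<Prod>i\<in>UNIV. - g i (a$i) + g i (b$i))"
    by simp
  also have "\<dots> = (\<Sum>S\<in>Pow UNIV. (\<Prod>i\<in>S. - g i (a$i)) * (\<Prod>i\<in>UNIV - S. g i (b$i)))"
    by (rule prod_add) simp
  also have "\<dots> = (\<Sum>S\<in>UNIV. (-1)^card S * (\<Prod>i\<in>UNIV. g i (corner a b S $ i)))"
  proof (simp, rule sum.cong)
    fix S :: "'n set"
    have "(\<Prod>i\<in>UNIV. g i (corner a b S $ i)) = (\<Prod>i\<in>S. g i (corner a b S $ i)) * (\<Prod>i\<in>UNIV - S. g i (corner a b S $ i))"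
      by (subst prod.subset_diff[of S UNIV]) (auto simp: mult.commute)
    also have "\<dots> = (\<Prod>i\<in>S. g i (a $ i)) * (\<Prod>i\<in>UNIV - S. g i (b $ i))"
      by (intro arg_cong2[where f="(*)"] prod.cong) auto
    finally show "(\<Prod>i\<in>S. - g i (a$i)) * (\<Prod>i\<in>UNIV - S. g i (b$i)) = (-1)^card S * (\<Prod>i\<in>UNIV. g i (if i \<in> S then a $ i else b $ i))"
      by (simp add: prod_uminus)
  qed simp
  finally show ?thesis by (simp add: box_increment_def)
qed

definition set_coord :: "real^'n \<Rightarrow> 'n \<Rightarrow> real \<Rightarrow> real^'n" where
  "set_coord a i c = (\<chi> j. if j = i then c else a$j)"

text \<open>Pairing the vertices that differ only in coordinate \<open>i\<close> isolates the dependence on that coordinate.\<close>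

lemma box_increment_pair:
  "box_increment f a b = (\<Sum>S\<in>{S. i \<notin> S}. (-1)^card S * (f (set_coord (corner a b S) i (b$i)) - f (set_coord (corner a b S) i (a$i))))"
proof -
  have U: "(UNIV::'a set set) = {S. i \<notin> S} \<union> insert i ` {S. i \<notin> S}"
  proof -
    have "S \<in> insert i ` {S. i \<notin> S}" if "i \<in> S" for S
      using that by (intro image_eqI[of _ _ "S - {i}"]) auto
    then show ?thesis by auto
  qed
  have inj: "inj_on (insert i) {S. i \<notin> S}"
    by (auto simp: inj_on_def)
  have "box_increment f a b = (\<Sum>S\<in>{S. i \<notin> S}. (-1)^card S * f (corner a b S))
     + (\<Sum>S\<in>{S. i \<notin> S}. (-1)^card (insert i S) * f (corner a b (insert i S)))"
    unfolding box_increment_def by (subst U, subst sum.union_disjoint) (auto simp: sum.reindex[OF inj])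
  also have "\<dots> = (\<Sum>S\<in>{S. i \<notin> S}. (-1)^card S * (f (set_coord (corner a b S) i (b$i)) - f (set_coord (corner a b S) i (a$i))))"
    unfolding sum.distrib[symmetric]
  proof (rule sum.cong)
    fix S assume "S \<in> {S. i \<notin> S}"
    then have "corner a b S = set_coord (corner a b S) i (b$i)" "corner a b (insert i S) = set_coord (corner a b S) i (a$i)"
       "card (insert i S) = Suc (card S)"
      by (auto simp: vec_eq_iff set_coord_def)
    then show "(-1)^card S * f (corner a b S) + (-1)^card (insert i S) * f (corner a b (insert i S))
       = (-1)^card S * (f (set_coord (corner a b S) i (b$i)) - f (set_coord (corner a b S) i (a$i)))"
      by (simp add: algebra_simps)
  qed simp
  finally show ?thesis .
qed

lemma box_increment_split: "box_increment f a b = box_increment f a (set_coord b i c) + box_increment f (set_coord a i c) b"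
proof -
  have 1: "set_coord (corner a (set_coord b i c) S) i = set_coord (corner a b S) i"
    "set_coord (corner (set_coord a i c) b S) i = set_coord (corner a b S) i" for S
    by (auto simp: vec_eq_iff set_coord_def fun_eq_iff)
  have 2: "set_coord x i c $ i = c" for x by (simp add: set_coord_def)
  show ?thesis
    unfolding box_increment_pair[of f _ _ i] 1 2 sum.distrib[symmetric]
    by (simp add: algebra_simps)
qed

text \<open>Grids have their own dyadic level \<open>N i\<close> in each coordinate, so that one coordinate can be refined
  at a time.\<close>

definition grid_point :: "('n \<Rightarrow> nat) \<Rightarrow> ('n \<Rightarrow> nat) \<Rightarrow> real^'n" where
  "grid_point N k = (\<chi> i. real (k i) / 2 ^ N i)"

lemma grid_point_nth [simp]: "grid_point N k $ i = real (k i) / 2 ^ N i"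
  by (simp add: grid_point_def)

definition cell_increment :: "(real^'n \<Rightarrow> real) \<Rightarrow> ('n \<Rightarrow> nat) \<Rightarrow> ('n \<Rightarrow> nat) \<Rightarrow> real" where
  "cell_increment f N k = box_increment f (grid_point N k) (grid_point N (\<lambda>i. k i + 1))"

text \<open>On the grid, \<open>f\<close> is a linear combination of products of one-dimensional point masses. For a product,
  the sum over the cells is the product of telescoping sums.\<close>

lemma box_increment_eq_sum_cells:
  assumes pq: "\<And>i. p i \<le> q i"
  shows "box_increment f (grid_point N p) (grid_point N q) = (\<Sum>k\<in>PiE UNIV (\<lambda>i. {p i..<q i}). cell_increment f N k)"
proof -
  define Y where "Y = PiE UNIV (\<lambda>i. {p i..q i})"
  have fin: "finite Y" unfolding Y_def by (rule finite_PiE) auto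
  define e where "e y i z = (if z = real (y i) / 2 ^ N i then 1 else (0::real))"
    for y :: "'a \<Rightarrow> nat" and i z
  \<comment> \<open>\<open>F\<close> agrees with \<open>f\<close> on the grid points of the box and is a combination of products.\<close>
  define F where "F x = (\<Sum>y\<in>Y. f (grid_point N y) * (\<Prod>i\<in>UNIV. e y i (x$i)))" for x
  have e: "(\<Prod>i\<in>UNIV. e y i (grid_point N z $ i)) = (if z = y then 1 else 0)" for y z
  proof (cases "z = y")
    case False
    then obtain i where "z i \<noteq> y i" by auto
    then have "e y i (grid_point N z $ i) = 0" by (simp add: e_def)
    with False show ?thesis by (simp add: prod_zero_iff) blast
  qed (simp add: e_def)
  have F: "F (grid_point N z) = f (grid_point N z)" if "z \<in> Y" for z
    unfolding F_def e using that fin by (simp add: if_distrib cong: if_cong)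
  have cor: "corner (grid_point N r) (grid_point N s) S = grid_point N (\<lambda>i. if i \<in> S then r i else s i)" for r s S
    by (simp add: vec_eq_iff)
  have inc_F: "box_increment f (grid_point N r) (grid_point N s) = (\<Sum>y\<in>Y. f (grid_point N y) * (\<Prod>i\<in>UNIV. e y i (grid_point N s $ i) - e y i (grid_point N r $ i)))"
    if "r \<in> Y" "s \<in> Y" for r s
  proof -
    have "box_increment f (grid_point N r) (grid_point N s) = box_increment F (grid_point N r) (grid_point N s)"
      by (rule box_increment_cong, unfold cor, rule F[symmetric]) (use that in \<open>auto simp: Y_def PiE_iff\<close>)
    also have "\<dots> = (\<Sum>y\<in>Y. f (grid_point N y) * (\<Prod>i\<in>UNIV. e y i (grid_point N s $ i) - e y i (grid_point N r $ i)))"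
      unfolding F_def box_increment_sum box_increment_prod ..
    finally show ?thesis .
  qed
  have "(\<Sum>k\<in>PiE UNIV (\<lambda>i. {p i..<q i}). cell_increment f N k) = 
     (\<Sum>k\<in>PiE UNIV (\<lambda>i. {p i..<q i}). \<Sum>y\<in>Y. f (grid_point N y) * (\<Prod>i\<in>UNIV. e y i (real (k i + 1) / 2^N i) - e y i (real (k i) / 2^N i)))"
    unfolding cell_increment_def
    by (rule sum.cong[OF refl], subst inc_F) (auto simp: Y_def PiE_iff Suc_le_eq less_imp_le intro: le_SucI)
  also have "\<dots> = (\<Sum>y\<in>Y. f (grid_point N y) * (\<Sum>k\<in>PiE UNIV (\<lambda>i. {p i..<q i}). \<Prod>i\<in>UNIV. e y i (real (k i + 1) / 2^N i) - e y i (real (k i) / 2^N i)))"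
    by (subst sum.swap) (simp add: sum_distrib_left)
  also have "\<dots> = (\<Sum>y\<in>Y. f (grid_point N y) * (\<Prod>i\<in>UNIV. \<Sum>j\<in>{p i..<q i}. e y i (real (j + 1) / 2^N i) - e y i (real j / 2^N i)))"
    by (subst prod_sum_PiE) auto
  also have "\<dots> = (\<Sum>y\<in>Y. f (grid_point N y) * (\<Prod>i\<in>UNIV. e y i (real (q i) / 2^N i) - e y i (real (p i) / 2^N i)))"
    using pq by (simp add: sum_Suc_diff'[of _ _ "\<lambda>j. e _ _ (real j / 2^ _)", simplified])
  also have "\<dots> = box_increment f (grid_point N p) (grid_point N q)"
    by (subst inc_F) (use pq in \<open>auto simp: Y_def PiE_iff\<close>)
  finally show ?thesis ..
qed

lemma cell_increment_split:
  "cell_increment f N k = cell_increment f (N(i := Suc (N i))) (k(i := 2 * k i)) + cell_increment f (N(i := Suc (N i))) (k(i := 2 * k i + 1))"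
proof -
  have "cell_increment f N k = box_increment f (grid_point N k) (set_coord (grid_point N (\<lambda>i. k i + 1)) i ((2 * real (k i) + 1) / 2 ^ Suc (N i)))
    + box_increment f (set_coord (grid_point N k) i ((2 * real (k i) + 1) / 2 ^ Suc (N i))) (grid_point N (\<lambda>i. k i + 1))"
    unfolding cell_increment_def by (rule box_increment_split)
  moreover have "grid_point N k = grid_point (N(i := Suc (N i))) (k(i := 2 * k i))"
   "set_coord (grid_point N (\<lambda>i. k i + 1)) i ((2 * real (k i) + 1) / 2 ^ Suc (N i)) = grid_point (N(i := Suc (N i))) (\<lambda>j. (k(i := 2 * k i)) j + 1)"
   "set_coord (grid_point N k) i ((2 * real (k i) + 1) / 2 ^ Suc (N i)) = grid_point (N(i := Suc (N i))) (k(i := 2 * k i + 1))"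
   "grid_point N (\<lambda>i. k i + 1) = grid_point (N(i := Suc (N i))) (\<lambda>j. (k(i := 2 * k i + 1)) j + 1)"
    by (auto simp: vec_eq_iff set_coord_def field_simps)
  ultimately show ?thesis unfolding cell_increment_def by metis
qed

section \<open>Smooth cutoff functions\<close>

text \<open>For \<open>p = 1\<close> this is the smooth function \<open>exp (-1/x)\<close> that vanishes to infinite order at 0. The
  polynomial factor makes the family closed under differentiation.\<close>

definition flat_exp :: "real poly \<Rightarrow> real \<Rightarrow> real" where
  "flat_exp p x = (if x > 0 then poly p (1/x) * exp (-1/x) else 0)"

definition flat_exp_deriv :: "real poly \<Rightarrow> real poly" where
  "flat_exp_deriv p = [:0,0,1:] * (p - pderiv p)"

lemma poly_div_exp_tendsto_0: "((\<lambda>x. poly p x / exp x) \<longlongrightarrow> (0::real)) at_top"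
proof -
  have "((\<lambda>x. \<Sum>i\<le>degree p. coeff p i * (x^i / exp x)) \<longlongrightarrow> (\<Sum>i\<le>degree p. coeff p i * 0)) at_top"
    by (intro tendsto_sum tendsto_mult tendsto_const tendsto_power_div_exp_0)
  then show ?thesis by (simp add: poly_altdef sum_divide_distrib)
qed

lemma flat_exp_has_derivative:
  "(flat_exp p has_real_derivative flat_exp (flat_exp_deriv p) x) (at x)"
proof -
  consider "x > 0" | "x < 0" | "x = 0" by linarith
  then show ?thesis
  proof cases
    case 1
    have "((\<lambda>x. poly p (1/x) * exp (-1/x)) has_real_derivative flat_exp (flat_exp_deriv p) x) (at x)"
      using 1 by (auto intro!: derivative_eq_intros poly_DERIV[THEN DERIV_chain2]
          simp: flat_exp_def flat_exp_deriv_def field_simps power2_eq_square)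
    then show ?thesis
      by (rule has_field_derivative_transform_within_open[of _ _ _ "{0<..}"])
         (use 1 in \<open>auto simp: flat_exp_def\<close>)
  next
    case 2
    have "((\<lambda>x. 0) has_real_derivative flat_exp (flat_exp_deriv p) x) (at x)"
      using 2 by (auto simp: flat_exp_def)
    then show ?thesis
      by (rule has_field_derivative_transform_within_open[of _ _ _ "{..<0}"])
         (use 2 in \<open>auto simp: flat_exp_def\<close>)
  next
    case 3
    have "((\<lambda>h. flat_exp p h / h) \<longlongrightarrow> 0) (at 0)"
    proof (rule filterlim_split_at)
      have "eventually (\<lambda>h::real. flat_exp p h / h = 0) (at_left 0)"
        by (auto simp: eventually_at_filter flat_exp_def)
      then show "((\<lambda>h. flat_exp p h / h) \<longlongrightarrow> 0) (at_left 0)"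
        by (rule tendsto_eventually)
      \<comment> \<open>With \<open>t = 1/h\<close> the difference quotient at 0 is \<open>t \<cdot> p(t) / exp t\<close>.\<close>
      have "((\<lambda>h::real. poly ([:0,1:] * p) (inverse h) / exp (inverse h)) \<longlongrightarrow> 0) (at_right 0)"
        by (rule filterlim_compose[OF poly_div_exp_tendsto_0 filterlim_inverse_at_top_right])
      moreover have "eventually (\<lambda>h::real. poly ([:0,1:] * p) (inverse h) / exp (inverse h) = flat_exp p h / h) (at_right 0)"
        by (auto simp: eventually_at_filter flat_exp_def exp_minus field_simps)
      ultimately show "((\<lambda>h. flat_exp p h / h) \<longlongrightarrow> 0) (at_right 0)"
        by (rule Lim_transform_eventually)
    qed
    then show ?thesis using 3 by (simp add: has_field_derivative_iff flat_exp_def)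
  qed
qed

definition smooth_seq :: "(nat \<Rightarrow> real \<Rightarrow> real) \<Rightarrow> bool" where
  "smooth_seq G \<longleftrightarrow> (\<forall>m x. (G m has_real_derivative G (Suc m) x) (at x))"

definition smooth :: "(real \<Rightarrow> real) \<Rightarrow> bool" where
  "smooth g \<longleftrightarrow> (\<exists>G. G 0 = g \<and> smooth_seq G)"

lemma smooth_flat_exp: "smooth (flat_exp p)"
  unfolding smooth_def smooth_seq_def
  by (rule exI[of _ "\<lambda>m. flat_exp ((flat_exp_deriv ^^ m) p)"]) (auto intro: flat_exp_has_derivative)

lemma smooth_affine:
  assumes "smooth g"
  shows "smooth (\<lambda>x. g (a * x + b))"
proof -
  obtain G where G: "G 0 = g" "\<And>m x. (G m has_real_derivative G (Suc m) x) (at x)"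
    using assms by (auto simp: smooth_def smooth_seq_def)
  have "((\<lambda>x. a^m * G m (a*x+b)) has_real_derivative a^Suc m * G (Suc m) (a*x+b)) (at x)" for m x
    by (auto intro!: derivative_eq_intros DERIV_chain2[OF G(2)])
  then show ?thesis unfolding smooth_def smooth_seq_def
    by (intro exI[of _ "\<lambda>m x. a^m * G m (a*x+b)"]) (auto simp: G(1))
qed

lemma smooth_cmult:
  assumes "smooth g"
  shows "smooth (\<lambda>x. c * g x)"
proof -
  obtain G where G: "G 0 = g" "\<And>m x. (G m has_real_derivative G (Suc m) x) (at x)"
    using assms by (auto simp: smooth_def smooth_seq_def)
  show ?thesis unfolding smooth_def smooth_seq_def
    by (intro exI[of _ "\<lambda>m x. c * G m x"]) (auto simp: G(1) intro!: derivative_eq_intros G(2))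
qed

lemma smooth_diff:
  assumes "smooth g" "smooth h"
  shows "smooth (\<lambda>x. g x - h x)"
proof -
  obtain G where G: "G 0 = g" "\<And>m x. (G m has_real_derivative G (Suc m) x) (at x)"
    using assms by (auto simp: smooth_def smooth_seq_def)
  obtain H where H: "H 0 = h" "\<And>m x. (H m has_real_derivative H (Suc m) x) (at x)"
    using assms by (auto simp: smooth_def smooth_seq_def)
  show ?thesis unfolding smooth_def smooth_seq_def
    by (intro exI[of _ "\<lambda>m x. G m x - H m x"]) (auto simp: G(1) H(1) intro!: derivative_eq_intros G(2) H(2))
qed

lemma smooth_antiderivative:
  assumes "smooth g" "\<And>x. (B has_real_derivative g x) (at x)"
  shows "smooth B"
proof -
  obtain G where G: "G 0 = g" "\<And>m x. (G m has_real_derivative G (Suc m) x) (at x)"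
    using assms by (auto simp: smooth_def smooth_seq_def)
  show ?thesis unfolding smooth_def smooth_seq_def
    using assms(2) G by (intro exI[of _ "case_nat B G"]) (auto split: nat.split)
qed

text \<open>By Leibniz, the derivatives of the product stay among the sums of products \<open>G a \<cdot> H b\<close>; a list of
  pairs \<open>(a, b)\<close> records such a sum, and \<open>D\<close> below is differentiation on lists.\<close>

lemma smooth_mult:
  assumes "smooth g" "smooth h"
  shows "smooth (\<lambda>x. g x * h x)"
proof -
  obtain G where G: "G 0 = g" "\<And>m x. (G m has_real_derivative G (Suc m) x) (at x)"
    using assms by (auto simp: smooth_def smooth_seq_def)
  obtain H where H: "H 0 = h" "\<And>m x. (H m has_real_derivative H (Suc m) x) (at x)"
    using assms by (auto simp: smooth_def smooth_seq_def)
  define D where "D L = concat (map (\<lambda>(a, b). [(Suc a, b), (a, Suc b)]) L)" for L :: "(nat \<times> nat) list"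
  define F where "F L x = (\<Sum>(a, b)\<leftarrow>L. G a x * H b x)" for L x
  have "(F L has_real_derivative F (D L) x) (at x)" for L x
  proof (induction L)
    case (Cons p L)
    obtain a b where p: "p = (a, b)" by force
    have "((\<lambda>x. G a x * H b x + F L x) has_real_derivative (G (Suc a) x * H b x + G a x * H (Suc b) x + F (D L) x)) (at x)"
      by (auto intro!: derivative_eq_intros Cons G H)
    then show ?case by (simp add: F_def D_def p add.assoc)
  qed (simp add: F_def D_def)
  then show ?thesis unfolding smooth_def smooth_seq_def
    by (intro exI[of _ "\<lambda>m. F ((D ^^ m) [(0,0)])"]) (auto simp: F_def G(1) H(1))
qed

text \<open>A smooth function supported in the unit interval. As \<open>m\<close> grows, both factors increase to 1 inside
  the interval, so the bumps increase to its indicator.\<close>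

definition bump :: "nat \<Rightarrow> real \<Rightarrow> real" where
  "bump m x = flat_exp 1 (real m * x) * flat_exp 1 (real m * (1 - x))"

lemma flat_exp_1_bounds: "0 \<le> flat_exp 1 x" "flat_exp 1 x \<le> 1"
  by (auto simp: flat_exp_def)

lemma bump_bounds: "0 \<le> bump m x" "bump m x \<le> 1"
  unfolding bump_def by (auto intro: mult_le_one simp: flat_exp_1_bounds)

lemma bump_eq_0: "x \<notin> {0<..<1} \<Longrightarrow> bump m x = 0"
  by (auto simp: bump_def flat_exp_def zero_less_mult_iff)

lemma smooth_bump: "smooth (bump m)"
proof -
  have "smooth (\<lambda>x. flat_exp 1 (real m * x + 0) * flat_exp 1 (- real m * x + real m))"
    by (intro smooth_mult smooth_affine smooth_flat_exp)
  then show ?thesis by (simp add: bump_def[abs_def] algebra_simps)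
qed

lemma bump_tendsto: "(\<lambda>m. bump m x) \<longlonglongrightarrow> indicator {0<..<1} x"
proof (cases "x \<in> {0<..<1}")
  case True
  have *: "(\<lambda>m. flat_exp 1 (real m * y)) \<longlonglongrightarrow> 1" if "y > 0" for y
  proof -
    have "(\<lambda>m. exp (- (inverse (real m) * (1 / y)))) \<longlonglongrightarrow> exp (- (0 * (1 / y)))"
      by (intro tendsto_intros lim_inverse_n)
    moreover have "eventually (\<lambda>m. exp (- (inverse (real m) * (1 / y))) = flat_exp 1 (real m * y)) sequentially"
      using eventually_gt_at_top[of 0] by eventually_elim (use that in \<open>auto simp: flat_exp_def field_simps\<close>)
    ultimately show ?thesis
      by (simp add: tendsto_cong)
  qed
  have "(\<lambda>m. flat_exp 1 (real m * x) * flat_exp 1 (real m * (1 - x))) \<longlonglongrightarrow> 1 * 1"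
    using True by (intro tendsto_mult *) auto
  then show ?thesis using True by (simp add: bump_def)
qed (simp add: bump_eq_0)

text \<open>The lower limit lies to the left of the support of the bump, so that the derivative at 0 is taken
  in the interior of the domain of integration.\<close>

definition step_up :: "nat \<Rightarrow> real \<Rightarrow> real" where
  "step_up m x = integral {-1..x} (bump m)"

lemma continuous_bump: "continuous_on A (bump m)"
proof -
  obtain G where "G 0 = bump m" "\<And>k x. (G k has_real_derivative G (Suc k) x) (at x)"
    using smooth_bump[of m] by (auto simp: smooth_def smooth_seq_def)
  then have "isCont (bump m) x" for x by (metis DERIV_isCont)
  then show ?thesis by (simp add: continuous_at_imp_continuous_on)
qed

lemma bump_integrable: "bump m integrable_on {a..b}"
  by (intro integrable_continuous_interval continuous_bump)

lemma step_up_below: "x \<le> 0 \<Longrightarrow> step_up m x = 0"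
  unfolding step_up_def by (subst integral_cong[of _ _ "\<lambda>_. 0"]) (auto simp: bump_eq_0)

lemma step_up_derivative: "(step_up m has_real_derivative bump m x) (at x)"
proof (cases "x > -1/2")
  case True
  have "((\<lambda>u. integral {-1..u} (bump m)) has_real_derivative bump m x) (at x within {-1..x+1})"
    using True by (intro integral_has_real_derivative continuous_bump) auto
  then have "((\<lambda>u. integral {-1..u} (bump m)) has_real_derivative bump m x) (at x)"
    using True by (subst (asm) at_within_interior) (auto simp: interior_atLeastAtMost_real)
  then show ?thesis by (simp add: step_up_def[abs_def])
next
  case False
  have "((\<lambda>x. 0) has_real_derivative bump m x) (at x)"
    using False by (auto simp: bump_eq_0)
  then show ?thesis
    by (rule has_field_derivative_transform_within_open[of _ _ _ "{..<0}"])
       (use False in \<open>auto simp: step_up_below\<close>)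
qed

lemma step_up_above: "x \<ge> 1 \<Longrightarrow> step_up m x = step_up m 1"
proof -
  assume x: "x \<ge> 1"
  have "integral {-1..1} (bump m) + integral {1..x} (bump m) = integral {-1..x} (bump m)"
    using x by (intro Henstock_Kurzweil_Integration.integral_combine bump_integrable) auto
  moreover have "integral {1..x} (bump m) = 0"
    by (subst integral_cong[of _ _ "\<lambda>_. 0"]) (auto simp: bump_eq_0)
  ultimately show ?thesis by (simp add: step_up_def)
qed

lemma step_up_bounds: "0 \<le> step_up m x" "step_up m x \<le> 1"
proof -
  show "0 \<le> step_up m x" unfolding step_up_def
    by (intro integral_nonneg bump_integrable) (simp add: bump_bounds)
  have *: "step_up m y \<le> 1" if y: "0 \<le> y" "y \<le> 1" for y
  proof -
    have "integral {-1..0} (bump m) + integral {0..y} (bump m) = integral {-1..y} (bump m)"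
      using y by (intro Henstock_Kurzweil_Integration.integral_combine bump_integrable) auto
    moreover have "integral {-1..0} (bump m) = 0"
      by (subst integral_cong[of _ _ "\<lambda>_. 0"]) (auto simp: bump_eq_0)
    moreover have "integral {0..y} (bump m) \<le> integral {0..y} (\<lambda>_. 1)"
      by (intro integral_le bump_integrable) (auto simp: bump_bounds)
    ultimately show ?thesis using y by (simp add: step_up_def)
  qed
  show "step_up m x \<le> 1"
    using *[of x] *[of 1] step_up_below[of x m] step_up_above[of x m]
    by (cases "x \<le> 0"; cases "x \<le> 1") auto
qed

text \<open>Smoothed tent with derivative close to 1 on the left and -1 on the right half of the unit interval.
  The two primitives of shifted bumps are both constant, with equal values, to the right of 1, which
  makes the tent compactly supported.\<close>

definition tent :: "nat \<Rightarrow> real \<Rightarrow> real" where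
  "tent m x = (step_up m (2 * x) - step_up m (2 * x - 1)) / 2"

lemma tent_derivative: "(tent m has_real_derivative (bump m (2 * x) - bump m (2 * x - 1))) (at x)"
  unfolding tent_def[abs_def]
  by (auto intro!: derivative_eq_intros DERIV_chain2[OF step_up_derivative])

lemma smooth_tent: "smooth (tent m)"
proof (rule smooth_antiderivative[OF _ tent_derivative])
  have "smooth (\<lambda>x. bump m (2 * x + 0) - bump m (2 * x + -1))"
    by (intro smooth_diff smooth_affine smooth_bump)
  then show "smooth (\<lambda>x. bump m (2 * x) - bump m (2 * x - 1))" by simp
qed

lemma tent_eq_0: "x \<notin> {0<..<1} \<Longrightarrow> tent m x = 0"
  using step_up_above[of "2*x" m] step_up_above[of "2*x-1" m]
  by (auto simp: tent_def step_up_below not_less)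

lemma abs_tent_le: "\<bar>tent m x\<bar> \<le> 1 / 2"
  using step_up_bounds[of m "2*x"] step_up_bounds[of m "2*x-1"] by (auto simp: tent_def)

lemma has_derivative_prod_coords:
  fixes G :: "'n::finite \<Rightarrow> real \<Rightarrow> real"
  assumes "\<And>j. (G j has_real_derivative G' j) (at (x$j))"
  shows "((\<lambda>x. \<Prod>j\<in>UNIV. G j (x$j)) has_derivative
      (\<lambda>h. \<Sum>i\<in>UNIV. (G' i * h$i) * (\<Prod>j\<in>UNIV-{i}. G j (x$j)))) (at x)"
proof (rule has_derivative_prod)
  fix i :: 'n
  show "((\<lambda>x. G i (x$i)) has_derivative (\<lambda>h. G' i * h$i)) (at x)"
    using has_derivative_compose[of "\<lambda>x. x$i" "\<lambda>h. h$i" x UNIV "G i" "\<lambda>y. G' i * y"] assms[of i]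
    by (simp add: has_field_derivative_def bounded_linear_imp_has_derivative bounded_linear_vec_nth)
qed

lemma partial_deriv_sum_prod:
  fixes G :: "'l \<Rightarrow> 'n::finite \<Rightarrow> real \<Rightarrow> real"
  assumes "finite L" and "\<And>l j x. (G l j has_real_derivative G' l j x) (at x)"
  shows "(\<lambda>x. \<Sum>l\<in>L. c l * (\<Prod>j\<in>UNIV. G l j (x$j))) differentiable (at x)"
    and "partial_deriv i (\<lambda>x. \<Sum>l\<in>L. c l * (\<Prod>j\<in>UNIV. G l j (x$j)))
       = (\<lambda>x. \<Sum>l\<in>L. c l * (\<Prod>j\<in>UNIV. if j = i then G' l j (x$j) else G l j (x$j)))"
proof -
  have D: "((\<lambda>x. \<Sum>l\<in>L. c l * (\<Prod>j\<in>UNIV. G l j (x$j))) has_derivative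
     (\<lambda>h. \<Sum>l\<in>L. c l * (\<Sum>i\<in>UNIV. (G' l i (x$i) * h$i) * (\<Prod>j\<in>UNIV-{i}. G l j (x$j))))) (at x)" for x
    by (intro has_derivative_sum has_derivative_mult_right has_derivative_prod_coords assms)
  show "(\<lambda>x. \<Sum>l\<in>L. c l * (\<Prod>j\<in>UNIV. G l j (x$j))) differentiable (at x)"
    using D by (auto simp: differentiable_def)
  show "partial_deriv i (\<lambda>x. \<Sum>l\<in>L. c l * (\<Prod>j\<in>UNIV. G l j (x$j)))
       = (\<lambda>x. \<Sum>l\<in>L. c l * (\<Prod>j\<in>UNIV. if j = i then G' l j (x$j) else G l j (x$j)))"
  proof
    fix x :: "real^'n"
    have "(\<Sum>k\<in>UNIV. (G' l k (x$k) * axis i 1 $ k) * (\<Prod>j\<in>UNIV-{k}. G l j (x$j)))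
       = (\<Prod>j\<in>UNIV. if j = i then G' l j (x$j) else G l j (x$j))" for l
    proof -
      have "(\<Sum>k\<in>UNIV. (G' l k (x$k) * axis i 1 $ k) * (\<Prod>j\<in>UNIV-{k}. G l j (x$j)))
        = (\<Sum>k\<in>UNIV. if k = i then G' l i (x$i) * (\<Prod>j\<in>UNIV-{i}. G l j (x$j)) else 0)"
        by (rule sum.cong) (auto simp: axis_def)
      also have "\<dots> = G' l i (x$i) * (\<Prod>j\<in>UNIV-{i}. G l j (x$j))" by simp
      also have "\<dots> = (\<Prod>j\<in>UNIV. if j = i then G' l j (x$j) else G l j (x$j))"
        by (subst (2) prod.remove[of _ i]) (auto intro!: prod.cong)
      finally show ?thesis .
    qed
    then show "partial_deriv i (\<lambda>x. \<Sum>l\<in>L. c l * (\<Prod>j\<in>UNIV. G l j (x$j))) x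
       = (\<Sum>l\<in>L. c l * (\<Prod>j\<in>UNIV. if j = i then G' l j (x$j) else G l j (x$j)))"
      by (simp add: partial_deriv_def frechet_derivative_at[OF D, symmetric])
  qed
qed

text \<open>Finite sums of products of one-variable functions are stable under partial derivatives, which only
  replace one factor in each product. Hence the induction runs over all choices \<open>m\<close> of the
  orders of differentiation.\<close>

lemma C_k_sum_prod:
  fixes g :: "'l \<Rightarrow> 'n::finite \<Rightarrow> real \<Rightarrow> real"
  assumes "finite L" and "\<And>l j. smooth (g l j)"
  shows "C_k k (\<lambda>x. \<Sum>l\<in>L. c l * (\<Prod>j\<in>UNIV. g l j (x$j)))"
proof -
  have "\<exists>G. G 0 = g l j \<and> smooth_seq G" for l j using assms(2)[of l j] by (simp add: smooth_def)
  then obtain G where G: "\<And>l j. G l j 0 = g l j" "\<And>l j. smooth_seq (G l j)" by metis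
  have "C_k k (\<lambda>x. \<Sum>l\<in>L. c l * (\<Prod>j\<in>UNIV. G l j (m l j) (x$j)))" for m
  proof (induction k arbitrary: m)
    case 0
    have "(\<lambda>x. \<Sum>l\<in>L. c l * (\<Prod>j\<in>UNIV. G l j (m l j) (x$j))) differentiable (at x)" for x
      using G(2) by (intro partial_deriv_sum_prod(1)[where G'="\<lambda>l j. G l j (Suc (m l j))"] assms)
        (auto simp: smooth_seq_def)
    then show ?case
      by (auto simp: continuous_on_eq_continuous_at differentiable_imp_continuous_within)
  next
    case (Suc k)
    have 1: "(\<lambda>x. \<Sum>l\<in>L. c l * (\<Prod>j\<in>UNIV. G l j (m l j) (x$j))) differentiable (at x)" for x
      using G(2) by (intro partial_deriv_sum_prod(1)[where G'="\<lambda>l j. G l j (Suc (m l j))"] assms)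
        (auto simp: smooth_seq_def)
    have 2: "partial_deriv i (\<lambda>x. \<Sum>l\<in>L. c l * (\<Prod>j\<in>UNIV. G l j (m l j) (x$j)))
      = (\<lambda>x. \<Sum>l\<in>L. c l * (\<Prod>j\<in>UNIV. G l j (if j = i then Suc (m l j) else m l j) (x$j)))" for i
      using G(2) by (subst partial_deriv_sum_prod(2)[where G'="\<lambda>l j. G l j (Suc (m l j))", OF assms(1)])
        (auto simp: smooth_seq_def intro!: ext sum.cong arg_cong2[where f="(*)"] prod.cong)
    show ?case using 1 Suc[of "\<lambda>l j. if j = _ then Suc (m l j) else m l j"]
      by (auto simp: differentiable_on_def 2 differentiable_at_withinI)
  qed
  from this[of "\<lambda>_ _. 0"] show ?thesis by (simp add: G)
qed

section \<open>Testing the gradient of a BV function\<close>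

lemma le_if_le_plus_small:
  fixes x y K :: real
  assumes "K \<ge> 0" "\<And>e. 0 < e \<Longrightarrow> x \<le> y + e * K"
  shows "x \<le> y"
proof (rule field_le_epsilon)
  fix d :: real assume "d > 0"
  then have "d / (K + 1) > 0" using assms(1) by simp
  from assms(2)[OF this] have "x \<le> y + d * (K / (K + 1))" by simp
  also have "d * (K / (K + 1)) \<le> d * 1"
    using assms(1) \<open>d > 0\<close> by (intro mult_left_mono) auto
  finally show "x \<le> y + d" by simp
qed

lemma sum_norm_le_total_variation:
  fixes \<nu> :: "(real^'n) set \<Rightarrow> real^'n" and g :: "real^'n \<Rightarrow> int"
  assumes "g \<in> borel \<rightarrow>\<^sub>M count_space UNIV" and "finite I"
  shows "(\<Sum>k\<in>I. ennreal (norm (\<nu> (g -` {k})))) \<le> total_variation \<nu> UNIV"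
proof -
  define E where "E m = g -` {int_decode m}" for m
  have meas: "g -` {k} \<in> sets borel" for k
    using measurable_sets[OF assms(1), of "{k}"] by simp
  have E: "range E \<subseteq> sets borel" "disjoint_family E" "(\<Union>k. E k) = UNIV"
  proof -
    show "range E \<subseteq> sets borel" using meas by (auto simp: E_def)
    show "disjoint_family E" 
      by (auto simp: disjoint_family_on_def E_def int_decode_eq)
    have "x \<in> E (int_encode (g x))" for x by (simp add: E_def)
    then show "(\<Union>k. E k) = UNIV" by blast
  qed
  have "(\<Sum>k\<in>I. ennreal (norm (\<nu> (g -` {k})))) = (\<Sum>m\<in>int_encode ` I. ennreal (norm (\<nu> (E m))))"
    by (subst sum.reindex) (auto simp: E_def inj_on_def int_encode_eq)
  also have "\<dots> \<le> (\<Sum>m. ennreal (norm (\<nu> (E m))))"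
    by (rule sum_le_suminf) (use assms(2) in auto)
  also have "\<dots> \<le> total_variation \<nu> UNIV"
    unfolding total_variation_def by (rule SUP_upper) (use E in simp)
  finally show ?thesis .
qed

text \<open>Cut the range of \<open>\<phi>\<close> into intervals of length \<open>e\<close>. Up to an error proportional to \<open>e\<close>, the integral
  is a sum of values of \<open>\<phi>\<close> times \<open>\<nu>\<close> of the level sets, which form one of the partitions in the
  definition of the total variation.\<close>

lemma integral_diff_le_total_variation:
  fixes \<nu> :: "(real^'n) set \<Rightarrow> real^'n"
  assumes P: "finite_measure P" "sets P = sets borel"
    and N: "finite_measure N" "sets N = sets borel"
    and \<nu>: "\<And>A. A \<in> sets borel \<Longrightarrow> \<nu> A $ i = measure P A - measure N A"
    and fin: "total_variation \<nu> UNIV < \<infinity>"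
    and \<phi>: "\<phi> \<in> borel_measurable borel" "\<And>x. \<bar>\<phi> x\<bar> \<le> c"
  shows "\<bar>(\<integral>x. \<phi> x \<partial>P) - (\<integral>x. \<phi> x \<partial>N)\<bar> \<le> c * enn2real (total_variation \<nu> UNIV)"
proof (rule le_if_le_plus_small)
  let ?V = "enn2real (total_variation \<nu> UNIV)"
  define K where "K = ?V + measure P UNIV + measure N UNIV"
  show "K \<ge> 0" by (simp add: K_def)
  have c: "c \<ge> 0" using \<phi>(2)[of 0] by linarith
  fix e :: real assume e: "e > 0"
  define g where "g x = \<lfloor>\<phi> x / e\<rfloor>" for x
  have g: "g \<in> borel \<rightarrow>\<^sub>M count_space UNIV" unfolding g_def using \<phi>(1) by measurable
  define I where "I = {\<lfloor>- c / e\<rfloor>..\<lfloor>c / e\<rfloor>}"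
  have gI: "g x \<in> I" for x
  proof -
    have "- c \<le> \<phi> x" "\<phi> x \<le> c" using \<phi>(2)[of x] by auto
    then have "- c / e \<le> \<phi> x / e" "\<phi> x / e \<le> c / e" using e by (simp_all only: divide_right_mono less_imp_le)
    then show ?thesis unfolding I_def g_def by (auto intro: floor_mono)
  qed
  have close: "\<bar>\<phi> x - e * real_of_int (g x)\<bar> \<le> e" for x
  proof -
    have "real_of_int (g x) \<le> \<phi> x / e" "\<phi> x / e < real_of_int (g x) + 1" unfolding g_def by linarith+
    then have "real_of_int (g x) * e \<le> \<phi> x" "\<phi> x < (real_of_int (g x) + 1) * e"
      using e by (simp_all add: field_simps)
    then show ?thesis by (simp add: algebra_simps abs_le_iff)
  qed
  have s_eq: "e * real_of_int (g x) = (\<Sum>k\<in>I. (e * real_of_int k) * indicator (g -` {k}) x)" for x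
  proof -
    have "(\<Sum>k\<in>I. (e * real_of_int k) * indicator (g -` {k}) x) = (\<Sum>k\<in>I. if k = g x then e * real_of_int k else 0)"
      by (rule sum.cong) (auto simp: indicator_def)
    then show ?thesis using gI[of x] by (simp add: I_def)
  qed
  have meas: "g -` {k} \<in> sets borel" for k
    using measurable_sets[OF g, of "{k}"] by simp
  have one: "\<bar>(\<integral>x. \<phi> x \<partial>Q) - (\<Sum>k\<in>I. (e * real_of_int k) * measure Q (g -` {k}))\<bar> \<le> e * measure Q UNIV"
    if Q: "finite_measure Q" "sets Q = sets borel" for Q
  proof -
    interpret finite_measure Q by fact
    have sp: "space Q = UNIV" using sets_eq_imp_space_eq[OF Q(2)] by simp
    have m: "\<phi> \<in> borel_measurable Q" using \<phi>(1) Q(2) measurable_cong_sets by blast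
    have mg: "(\<lambda>x. e * real_of_int (g x)) \<in> borel_measurable Q"
      unfolding measurable_cong_sets[OF Q(2) refl] using g by measurable
    have i\<phi>: "integrable Q \<phi>"
      by (rule integrable_const_bound[of _ c]) (use \<phi>(2) m in auto)
    have ind: "integrable Q (\<lambda>x. indicator (g -` {k}) x :: real)" for k
      by (rule integrable_real_indicator) (use meas Q in \<open>auto simp: less_top[symmetric]\<close>)
    have i: "integrable Q (\<lambda>x. e * real_of_int (g x))"
      unfolding s_eq by (intro Bochner_Integration.integrable_sum integrable_mult_right ind)
    have eq: "(\<integral>x. e * real_of_int (g x) \<partial>Q) = (\<Sum>k\<in>I. (e * real_of_int k) * measure Q (g -` {k}))"
      unfolding s_eq by (subst Bochner_Integration.integral_sum) (auto simp: ind meas Q sp)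
    have "\<bar>(\<integral>x. \<phi> x \<partial>Q) - (\<integral>x. e * real_of_int (g x) \<partial>Q)\<bar> = \<bar>\<integral>x. \<phi> x - e * real_of_int (g x) \<partial>Q\<bar>"
      using i\<phi> i by simp
    also have "\<dots> \<le> (\<integral>x. \<bar>\<phi> x - e * real_of_int (g x)\<bar> \<partial>Q)"
      by (rule integral_abs_bound)
    also have "\<dots> \<le> (\<integral>x. e \<partial>Q)"
      by (intro integral_mono) (use i\<phi> i close in auto)
    also have "\<dots> = e * measure Q UNIV" by (simp add: sp)
    finally show ?thesis unfolding eq .
  qed
  have "\<bar>(\<Sum>k\<in>I. (e * real_of_int k) * measure P (g -` {k})) - (\<Sum>k\<in>I. (e * real_of_int k) * measure N (g -` {k}))\<bar>
     = \<bar>\<Sum>k\<in>I. (e * real_of_int k) * (\<nu> (g -` {k}) $ i)\<bar>"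
    by (simp add: \<nu> meas sum_subtractf algebra_simps)
  also have "\<dots> \<le> (\<Sum>k\<in>I. (c + e) * norm (\<nu> (g -` {k})))"
  proof (rule order_trans[OF sum_abs], rule sum_mono)
    fix k
    show "\<bar>(e * real_of_int k) * (\<nu> (g -` {k}) $ i)\<bar> \<le> (c + e) * norm (\<nu> (g -` {k}))"
    proof (cases "g -` {k} = {}")
      case True
      then show ?thesis using \<nu>[of "{}"] c e by simp
    next
      case False
      then obtain x where k: "k = g x" by auto
      have "\<bar>e * real_of_int k\<bar> \<le> c + e" unfolding k using close[of x] \<phi>(2)[of x] by linarith
      then show ?thesis using component_le_norm_cart[of "\<nu> (g -` {k})" i] c e
        unfolding abs_mult[of "e * real_of_int k"] by (intro mult_mono) auto
    qed
  qed
  also have "\<dots> = (c + e) * (\<Sum>k\<in>I. norm (\<nu> (g -` {k})))" by (simp add: sum_distrib_left)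
  also have "\<dots> \<le> (c + e) * ?V"
  proof (rule mult_left_mono)
    have "ennreal (\<Sum>k\<in>I. norm (\<nu> (g -` {k}))) \<le> total_variation \<nu> UNIV"
      using sum_norm_le_total_variation[OF g, of I \<nu>] by (simp add: I_def)
    then have "enn2real (ennreal (\<Sum>k\<in>I. norm (\<nu> (g -` {k})))) \<le> ?V"
      by (rule enn2real_mono) (use fin in \<open>simp add: infinity_ennreal_def\<close>)
    then show "(\<Sum>k\<in>I. norm (\<nu> (g -` {k}))) \<le> ?V" by (simp add: sum_nonneg)
  qed (use c e in simp)
  finally show "\<bar>(\<integral>x. \<phi> x \<partial>P) - (\<integral>x. \<phi> x \<partial>N)\<bar> \<le> c * ?V + e * K"
    using one[OF P] one[OF N] unfolding K_def distrib_left distrib_right by linarith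
qed

lemma C_k_imp_continuous: "C_k k \<phi> \<Longrightarrow> continuous_on UNIV \<phi>"
  by (cases k) (auto intro: differentiable_imp_continuous_on)

lemma BV_partial_deriv_bound:
  fixes u :: "real^'n \<Rightarrow> real"
  assumes u: "u \<in> BV_cube" and \<phi>: "test_function \<phi>" "\<And>x. \<bar>\<phi> x\<bar> \<le> c"
  shows "\<bar>\<integral>x. u x * partial_deriv i \<phi> x \<partial>lebesgue\<bar> \<le> c * enn2real (gradient_variation u)"
proof -
  define \<nu> where "\<nu> = (SOME \<nu>. distr_gradient u \<nu>)"
  have fin: "gradient_variation u < \<infinity>" using u by (simp add: BV_cube_def)
  then have ex: "\<exists>\<nu>. distr_gradient u \<nu>" by (auto simp: gradient_variation_def split: if_splits)
  then have tv: "gradient_variation u = total_variation \<nu> UNIV"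
    by (simp add: gradient_variation_def \<nu>_def)
  have "distr_gradient u \<nu>" unfolding \<nu>_def using ex by (rule someI_ex)
  then obtain P N :: "'n \<Rightarrow> (real^'n) measure"
    where PN: "\<And>i. finite_measure (P i) \<and> sets (P i) = sets borel \<and>
             finite_measure (N i) \<and> sets (N i) = sets borel"
      "\<And>i A. A \<in> sets borel \<Longrightarrow> \<nu> A $ i = measure (P i) A - measure (N i) A"
      "\<And>\<phi> i. test_function \<phi> \<Longrightarrow>
           (\<integral>x. u x * partial_deriv i \<phi> x \<partial>lebesgue)
             = - ((\<integral>x. \<phi> x \<partial>(P i)) - (\<integral>x. \<phi> x \<partial>(N i)))"
    unfolding distr_gradient_def by blast
  have "\<phi> \<in> borel_measurable borel"
    using \<phi>(1) by (intro borel_measurable_continuous_onI C_k_imp_continuous) (auto simp: test_function_def)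
  then show ?thesis
    unfolding PN(3)[OF \<phi>(1)] abs_minus_cancel tv
    using fin tv by (intro integral_diff_le_total_variation) (use PN \<phi> in auto)
qed

section \<open>Densities that are constant on grid cells\<close>

definition grid :: "('n::finite \<Rightarrow> nat) \<Rightarrow> ('n \<Rightarrow> nat) set" where
  "grid N = PiE UNIV (\<lambda>j. {..<2 ^ N j})"

definition cell :: "('n::finite \<Rightarrow> nat) \<Rightarrow> ('n \<Rightarrow> nat) \<Rightarrow> (real^'n) set" where
  "cell N k = box (grid_point N k) (grid_point N (\<lambda>j. k j + 1))"

text \<open>The value on each cell is the increment over the cell divided by its volume. Open cells are used, so
  that cells of one grid are disjoint; what happens on their boundaries is negligible.\<close>

definition cell_density :: "(real^'n \<Rightarrow> real) \<Rightarrow> ('n \<Rightarrow> nat) \<Rightarrow> real^'n \<Rightarrow> real" where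
  "cell_density f N x = (\<Sum>k\<in>grid N. 2 ^ sum N UNIV * cell_increment f N k * indicator (cell N k) x)"

lemma mem_grid: "k \<in> grid N \<longleftrightarrow> (\<forall>j. k j < 2 ^ N j)"
  by (simp add: grid_def PiE_iff)

lemma finite_grid [simp]: "finite (grid N)"
  unfolding grid_def by (rule finite_PiE) auto

lemma mem_cell_iff:
  "x \<in> cell N k \<longleftrightarrow> (\<forall>j. 2 ^ N j * x$j - real (k j) \<in> {0<..<1})"
  by (auto simp: cell_def mem_box_cart field_simps)

lemma cell_unique:
  assumes "x \<in> cell N k" "x \<in> cell N l" shows "k = l"
proof
  fix j
  have "\<bar>real (k j) - real (l j)\<bar> < 1" 
    using assms by (auto simp: mem_cell_iff dest!: spec[of _ j])
  then show "k j = l j" by linarith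
qed

lemma sum_grid_on_cell:
  assumes "k \<in> grid N" "x \<in> cell N k" "\<And>l. x \<notin> cell N l \<Longrightarrow> F l = (0::real)"
  shows "(\<Sum>l\<in>grid N. F l) = F k"
proof -
  have "(\<Sum>l\<in>grid N. F l) = (\<Sum>l\<in>{k}. F l)"
  proof (rule sum.mono_neutral_right)
    show "\<forall>l\<in>grid N - {k}. F l = 0"
    proof
      fix l assume "l \<in> grid N - {k}"
      then have "x \<notin> cell N l" using cell_unique[OF _ assms(2), of l] by blast
      then show "F l = 0" by (rule assms(3))
    qed
  qed (use assms(1) in auto)
  then show ?thesis by simp
qed

lemma abs_sum_grid_le:
  assumes "\<And>k. x \<notin> cell N k \<Longrightarrow> F k = (0::real)" "\<And>k. k \<in> grid N \<Longrightarrow> \<bar>F k\<bar> \<le> c" "0 \<le> c"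
  shows "\<bar>\<Sum>k\<in>grid N. F k\<bar> \<le> c"
proof (cases "\<exists>k\<in>grid N. x \<in> cell N k")
  case True
  then obtain k where k: "k \<in> grid N" "x \<in> cell N k" by blast
  then have "(\<Sum>l\<in>grid N. F l) = F k" using assms(1) by (rule sum_grid_on_cell)
  then show ?thesis using assms(2)[OF k(1)] by simp
next
  case False
  then have "(\<Sum>l\<in>grid N. F l) = 0" using assms(1) by (intro sum.neutral) blast
  then show ?thesis using assms(3) by simp
qed

lemma cell_density_on_cell:
  assumes "k \<in> grid N" "x \<in> cell N k"
  shows "cell_density f N x = 2 ^ sum N UNIV * cell_increment f N k"
  unfolding cell_density_def by (subst sum_grid_on_cell[OF assms]) (use assms in auto)

lemma abs_cell_density_le:
  assumes "\<And>k. k \<in> grid N \<Longrightarrow> \<bar>cell_increment f N k\<bar> \<le> b" "0 \<le> b"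
  shows "\<bar>cell_density f N x\<bar> \<le> 2 ^ sum N UNIV * b"
  unfolding cell_density_def
  by (rule abs_sum_grid_le[of x]) (use assms in \<open>auto simp: abs_mult indicator_def\<close>)

lemma cell_density_measurable [measurable]: "cell_density f N \<in> borel_measurable borel"
proof -
  have [measurable]: "cell N k \<in> sets borel" for k by (simp add: cell_def)
  show ?thesis unfolding cell_density_def[abs_def] by measurable
qed

lemma bounded_cell_density: "\<exists>B\<ge>0. \<forall>x. \<bar>cell_density f N x\<bar> \<le> B"
proof -
  have "\<bar>cell_density f N x\<bar> \<le> 2 ^ sum N UNIV * (\<Sum>k\<in>grid N. \<bar>cell_increment f N k\<bar>)" for x
    by (intro abs_cell_density_le member_le_sum sum_nonneg) auto
  then show ?thesis by (intro exI[of _ "2 ^ sum N UNIV * (\<Sum>k\<in>grid N. \<bar>cell_increment f N k\<bar>)"]) 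
     (auto intro!: mult_nonneg_nonneg sum_nonneg)
qed

text \<open>Points with irrational coordinates lie in the interior of a cell of every dyadic grid at once.\<close>

lemma AE_irrational: "AE x::real^'n in lebesgue. \<forall>j. x$j \<notin> \<rat>"
proof -
  have "AE x::real^'n in lebesgue. \<forall>q\<in>\<rat>. x$j \<noteq> q" for j
  proof (rule AE_ball_countable')
    fix q
    have "negligible {x::real^'n. x$j = q}"
      using negligible_standard_hyperplane[of "axis j 1 :: real^'n" q] by (simp add: inner_axis axis_in_Basis_iff)
    then have "{x::real^'n. x$j = q} \<in> null_sets lebesgue" by (simp add: negligible_iff_null_sets)
    then show "AE x::real^'n in lebesgue. x$j \<noteq> q" using AE_not_in by fastforce
  qed (rule countable_rat)
  then have "AE x::real^'n in lebesgue. \<forall>j\<in>UNIV. \<forall>q\<in>\<rat>. x$j \<noteq> q"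
    by (rule AE_finite_allI[OF finite_class.finite_UNIV])
  then show ?thesis by eventually_elim blast
qed

lemma irrational_in_cell:
  fixes x :: "real^'n"
  assumes "x \<in> unit_cube" "\<And>j. x$j \<notin> \<rat>"
  obtains k where "k \<in> grid N" "x \<in> cell N k"
proof
  define k where "k j = nat \<lfloor>2 ^ N j * x$j\<rfloor>" for j
  have x: "0 \<le> x$j" "x$j \<le> 1" for j using assms(1) by (auto simp: mem_box_cart)
  have x1: "x$j \<noteq> 1" for j using assms(2)[of j] by auto
  have le: "real (k j) \<le> 2 ^ N j * x$j" "2 ^ N j * x$j < real (k j) + 1" for j
    using x(1)[of j] by (auto simp: k_def)
  have ne: "2 ^ N j * x$j \<noteq> real (k j)" for j
  proof
    assume "2 ^ N j * x$j = real (k j)"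
    then have "x$j = real (k j) / 2 ^ N j" by (simp add: field_simps)
    then show False using assms(2)[of j] by simp
  qed
  show "x \<in> cell N k"
    unfolding mem_cell_iff
  proof
    fix j
    show "2 ^ N j * x$j - real (k j) \<in> {0<..<1}"
      using le[of j] ne[of j] by (simp only: greaterThanLessThan_iff, linarith)
  qed
  show "k \<in> grid N" unfolding mem_grid
  proof
    fix j
    have "2 ^ N j * x$j < 2 ^ N j * 1"
      using x[of j] x1[of j] by (intro mult_strict_left_mono) auto
    then have "real (k j) < 2 ^ N j" using le(1)[of j] by linarith
    then show "k j < 2 ^ N j" using of_nat_less_iff[of "k j" "2 ^ N j", where 'a=real] by simp
  qed
qed

lemma integrable_cell_density_mult:
  assumes "integrable lebesgue u"
  shows "integrable lebesgue (\<lambda>x. cell_density f N x * u x)"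
proof -
  obtain B where B: "\<And>x. \<bar>cell_density f N x\<bar> \<le> B" using bounded_cell_density[of f N] by blast
  have [measurable]: "u \<in> borel_measurable lebesgue" using assms by auto
  have [measurable]: "cell_density f N \<in> borel_measurable lebesgue"
    using cell_density_measurable by (simp add: measurable_completion)
  show ?thesis
  proof (rule Bochner_Integration.integrable_bound[of _ "\<lambda>x. B * u x"])
    show "AE x in lebesgue. norm (cell_density f N x * u x) \<le> norm (B * u x)"
      using B by (auto simp: abs_mult intro!: mult_right_mono order_trans[OF B])
  qed (use assms in auto)
qed

lemma T_functional_cell_density_eq:
  assumes "AE x in lebesgue. x \<notin> unit_cube \<longrightarrow> u x = 0" "integrable lebesgue u"
  shows "T_functional (cell_density f N) u = (\<integral>x. cell_density f N x * u x \<partial>lebesgue)"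
  unfolding T_functional_def set_lebesgue_integral_def
proof (rule integral_cong_AE)
  show m: "(\<lambda>x. cell_density f N x * u x) \<in> borel_measurable lebesgue"
    using integrable_cell_density_mult[OF assms(2)] by auto
  show "(\<lambda>x. indicator unit_cube x *\<^sub>R (cell_density f N x * u x)) \<in> borel_measurable lebesgue"
    by (intro borel_measurable_scaleR borel_measurable_indicator m) auto
  show "AE x in lebesgue. indicator unit_cube x *\<^sub>R (cell_density f N x * u x) = cell_density f N x * u x"
    using assms(1) by eventually_elim (auto simp: indicator_def)
qed

section \<open>Refining the grid in one coordinate\<close>

lemma grid_refine:
  assumes "k \<in> grid N"
  shows "k(i := 2 * k i) \<in> grid (N(i := Suc (N i)))" "k(i := 2 * k i + 1) \<in> grid (N(i := Suc (N i)))"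
proof -
  have "k i < 2 ^ N i" using assms by (auto simp: mem_grid)
  then have "2 * k i + 1 < 2 * 2 ^ N i" by linarith
  then show "k(i := 2 * k i) \<in> grid (N(i := Suc (N i)))" "k(i := 2 * k i + 1) \<in> grid (N(i := Suc (N i)))"
    using assms by (auto simp: mem_grid)
qed

text \<open>Integration by parts. The difference \<open>L\<close> of the two densities has opposite values on the two halves
  of each cell of the coarser grid. The test functions \<open>\<phi> m\<close>, a smoothed tent of height about
  \<open>2\<^sup>-\<^sup>N\<^sup>i\<close> in direction \<open>i\<close> times smoothed indicators in the other directions on each cell, have
  \<open>i\<close>-th derivatives that converge boundedly to \<open>L\<close>. Their supports in different cells are disjoint,
  so the sum over all cells is bounded by its largest term.\<close>

lemma cell_density_refine_bound:
  fixes f :: "real^'n \<Rightarrow> real" and u :: "real^'n \<Rightarrow> real"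
  assumes u: "u \<in> BV_cube"
    and b: "\<And>k. k \<in> grid (N(i := Suc (N i))) \<Longrightarrow> \<bar>cell_increment f (N(i := Suc (N i))) k\<bar> \<le> b"
  shows "\<bar>T_functional (cell_density f (N(i := Suc (N i)))) u - T_functional (cell_density f N) u\<bar>
    \<le> 2 ^ sum N UNIV * b / 2 ^ N i * enn2real (gradient_variation u)"
proof -
  let ?N = "N(i := Suc (N i))"
  \<comment> \<open>The two densities differ by \<open>c k\<close> on the lower and by \<open>- c k\<close> on the upper half of the cell \<open>k\<close>.\<close>
  define c where "c k = 2 ^ sum N UNIV * (cell_increment f ?N (k(i := 2 * k i)) - cell_increment f ?N (k(i := 2 * k i + 1)))" for k
  define y where "y k x j = 2 ^ N j * x$j - real (k j)" for k and x :: "real^'n" and j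
  define G where "G m k j t = (if j = i then tent m (2 ^ N j * t - real (k j)) / 2 ^ N j else bump m (2 ^ N j * t - real (k j)))"
    for m k j t
  define \<phi> where "\<phi> m x = (\<Sum>k\<in>grid N. c k * (\<Prod>j\<in>UNIV. G m k j (x$j)))" for m and x :: "real^'n"
  define L where "L x = (\<Sum>k\<in>grid N. c k * (\<Prod>j\<in>UNIV. if j = i then indicator {0<..<1} (2 * y k x j) - indicator {0<..<1} (2 * y k x j - 1) else indicator {0<..<1} (y k x j)))"
    for x :: "real^'n"
  have smG: "smooth (G m k j)" for m k j
  proof -
    have "smooth (\<lambda>t. (1 / 2 ^ N j) * tent m (2 ^ N j * t + - real (k j)))"
      "smooth (\<lambda>t. bump m (2 ^ N j * t + - real (k j)))"
      by (intro smooth_cmult smooth_affine smooth_tent smooth_bump)+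
    then show ?thesis by (cases "j = i") (simp_all add: G_def[abs_def])
  qed
  have G0: "(\<Prod>j\<in>UNIV. G m k j (x$j)) = 0" if x: "x \<notin> cell N k" for m k x
  proof -
    obtain j where j: "2 ^ N j * x$j - real (k j) \<notin> {0<..<1}" using x unfolding mem_cell_iff by blast
    have "G m k j (x$j) = 0" using tent_eq_0[OF j, of m] bump_eq_0[OF j, of m] by (cases "j = i") (simp_all add: G_def)
    then show ?thesis by (auto simp: prod_zero_iff)
  qed
  have b0: "0 \<le> b"
  proof -
    have "(\<lambda>_. 0) \<in> grid ?N" by (simp add: mem_grid)
    from b[OF this] show ?thesis by linarith
  qed
  have ci: "\<bar>c k\<bar> \<le> 2 ^ sum N UNIV * (2 * b)" if "k \<in> grid N" for k
  proof -
    have "\<bar>cell_increment f ?N (k(i := 2 * k i)) - cell_increment f ?N (k(i := 2 * k i + 1))\<bar> \<le> 2 * b"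
      using b[OF grid_refine(1)[OF that, of i]] b[OF grid_refine(2)[OF that, of i]] by linarith
    then show ?thesis unfolding c_def by (simp add: abs_mult)
  qed
  have \<phi>_bound: "\<bar>\<phi> m x\<bar> \<le> 2 ^ sum N UNIV * b / 2 ^ N i" for m x
    unfolding \<phi>_def
  proof (rule abs_sum_grid_le[of x])
    fix k assume k: "k \<in> grid N"
    have "\<bar>\<Prod>j\<in>UNIV. G m k j (x$j)\<bar> \<le> (\<Prod>j\<in>UNIV. if j = i then 1 / 2 / 2 ^ N i else 1)"
      unfolding abs_prod
      using divide_right_mono[OF abs_tent_le[of m "2 ^ N i * x$i - real (k i)"], of "2 ^ N i"]
      by (intro prod_mono) (auto simp: G_def bump_bounds abs_of_nonneg simp del: le_divide_eq_numeral1)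
    then have "\<bar>\<Prod>j\<in>UNIV. G m k j (x$j)\<bar> \<le> 1 / 2 / 2 ^ N i" by simp
    then have "\<bar>c k * (\<Prod>j\<in>UNIV. G m k j (x$j))\<bar> \<le> (2 ^ sum N UNIV * (2 * b)) * (1 / 2 / 2 ^ N i)"
      unfolding abs_mult using ci[OF k] b0 by (intro mult_mono) auto
    then show "\<bar>c k * (\<Prod>j\<in>UNIV. G m k j (x$j))\<bar> \<le> 2 ^ sum N UNIV * b / 2 ^ N i" by simp
  qed (simp_all add: G0 b0)
  have test: "test_function (\<phi> m)" for m
    unfolding test_function_def
  proof
    show "\<forall>k. C_k k (\<phi> m)" unfolding \<phi>_def[abs_def] by (intro allI C_k_sum_prod smG) simp
    have "{x. \<phi> m x \<noteq> 0} \<subseteq> unit_cube"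
    proof
      fix x assume "x \<in> {x. \<phi> m x \<noteq> 0}"
      then have "(\<Sum>k\<in>grid N. c k * (\<Prod>j\<in>UNIV. G m k j (x$j))) \<noteq> 0" by (simp add: \<phi>_def)
      then obtain k where k: "k \<in> grid N" and "c k * (\<Prod>j\<in>UNIV. G m k j (x$j)) \<noteq> 0"
        by (rule sum.not_neutral_contains_not_neutral)
      then have k2: "x \<in> cell N k" using G0[of x k m] by (metis mult_zero_right)
      have "0 \<le> x$j \<and> x$j \<le> 1" for j
      proof -
        have "real (k j) < 2 ^ N j * x$j" "2 ^ N j * x$j < real (k j) + 1" using k2[unfolded mem_cell_iff]
          by (auto dest!: spec[of _ j])
        moreover have "k j + 1 \<le> 2 ^ N j" using k by (auto simp: mem_grid Suc_le_eq)
        then have "real (k j) + 1 \<le> 2 ^ N j"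
          using of_nat_mono[of "k j + 1" "2 ^ N j", where 'a=real] by simp
        ultimately have "0 < 2 ^ N j * x$j" "2 ^ N j * x$j < 2 ^ N j * 1" by linarith+
        then show ?thesis by (simp add: zero_less_mult_iff)
      qed
      then show "x \<in> unit_cube" by (simp add: mem_box_cart)
    qed
    then have "closure {x. \<phi> m x \<noteq> 0} \<subseteq> unit_cube" by (intro closure_minimal) auto
    then show "compact (closure {x. \<phi> m x \<noteq> 0})"
      using compact_Int_closed[OF compact_cbox closed_closure, of 0 1 "{x. \<phi> m x \<noteq> 0}"] by (simp add: Int_absorb1)
  qed
  define D where "D m x = (\<Sum>k\<in>grid N. c k * (\<Prod>j\<in>UNIV. if j = i then bump m (2 * y k x j) - bump m (2 * y k x j - 1) else bump m (y k x j)))"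
    for m x
  have D: "partial_deriv i (\<phi> m) = D m" for m
  proof -
    have "\<exists>G'. \<forall>l j x. (G m l j has_real_derivative G' l j x) (at x)"
    proof -
      have "\<exists>g'. \<forall>x. (G m l j has_real_derivative g' x) (at x)" for l j
        using smG[of m l j] unfolding smooth_def smooth_seq_def by metis
      then show ?thesis by metis
    qed
    then obtain G' where G': "\<And>l j x. (G m l j has_real_derivative G' l j x) (at x)" by blast
    have G'i: "G' l i t = bump m (2 * (2 ^ N i * t - real (l i))) - bump m (2 * (2 ^ N i * t - real (l i)) - 1)" for l t
    proof (rule DERIV_unique[OF G'])
      show "(G m l i has_real_derivative bump m (2 * (2 ^ N i * t - real (l i))) - bump m (2 * (2 ^ N i * t - real (l i)) - 1)) (at t)"
        unfolding G_def[abs_def] by (auto intro!: derivative_eq_intros DERIV_chain2[OF tent_derivative])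
    qed
    show ?thesis
      unfolding \<phi>_def[abs_def] partial_deriv_sum_prod(2)[OF finite_grid G']
      by (intro ext) (auto simp: D_def y_def G'i G_def intro!: sum.cong prod.cong)
  qed
  have lim: "(\<lambda>m. D m x) \<longlonglongrightarrow> L x" for x
    unfolding D_def L_def
  proof (intro tendsto_sum tendsto_mult tendsto_const tendsto_prod)
    fix k j
    show "(\<lambda>m. if j = i then bump m (2 * y k x j) - bump m (2 * y k x j - 1) else bump m (y k x j))
      \<longlonglongrightarrow> (if j = i then indicator {0<..<1} (2 * y k x j) - indicator {0<..<1} (2 * y k x j - 1) else indicator {0<..<1} (y k x j))"
      by (cases "j = i") (simp_all add: bump_tendsto tendsto_diff)
  qed
  \<comment> \<open>A crude bound, uniform in \<open>m\<close>, is enough for dominated convergence.\<close>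
  have D_bound: "\<bar>D m x\<bar> \<le> (\<Sum>k\<in>grid N. \<bar>c k\<bar>)" for m x
    unfolding D_def
  proof (rule order_trans[OF sum_abs], rule sum_mono)
    fix k
    have "\<bar>\<Prod>j\<in>UNIV. if j = i then bump m (2 * y k x j) - bump m (2 * y k x j - 1) else bump m (y k x j)\<bar> \<le> (\<Prod>j\<in>(UNIV::'n set). 1)"
      unfolding abs_prod
    proof (rule prod_mono, intro conjI)
      fix j
      show "\<bar>if j = i then bump m (2 * y k x j) - bump m (2 * y k x j - 1) else bump m (y k x j)\<bar> \<le> 1"
        using bump_bounds[of m "2 * y k x j"] bump_bounds[of m "2 * y k x j - 1"] bump_bounds[of m "y k x j"] by auto
    qed simp
    then show "\<bar>c k * (\<Prod>j\<in>UNIV. if j = i then bump m (2 * y k x j) - bump m (2 * y k x j - 1) else bump m (y k x j))\<bar> \<le> \<bar>c k\<bar>"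
      unfolding abs_mult by (simp add: mult_left_le)
  qed
  have L_eq: "L x = cell_density f ?N x - cell_density f N x" if x: "x \<in> unit_cube" "\<And>j. x$j \<notin> \<rat>" for x
  proof -
    obtain k' where k': "k' \<in> grid ?N" "x \<in> cell ?N k'" using irrational_in_cell[OF x] by blast
    \<comment> \<open>\<open>k\<close> is the coarse cell around \<open>x\<close>; the parity of \<open>k' i\<close> tells in which half of it \<open>x\<close> lies.\<close>
    define k where "k = k'(i := k' i div 2)"
    have e: "k' = k(i := 2 * k i) \<or> k' = k(i := 2 * k i + 1)"
      by (cases "even (k' i)") (auto simp: k_def fun_eq_iff)
    have yi: "2 * 2 ^ N i * x$i - real (k' i) \<in> {0<..<1}" 
      using k'(2)[unfolded mem_cell_iff] by (auto dest: spec[of _ i])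
    have yi2: "y k x i \<in> {0<..<1}" "indicator {0<..<1} (2 * y k x i) - indicator {0<..<1} (2 * y k x i - 1) = 
       (if k' i = 2 * k i then 1 else (-1::real))"
      using yi e by (auto simp: y_def indicator_def)
    have yj: "y k x j \<in> {0<..<1}" if "j \<noteq> i" for j
      using k'(2)[unfolded mem_cell_iff] that by (auto simp: y_def k_def dest: spec[of _ j])
    have k: "k \<in> grid N" "x \<in> cell N k"
    proof -
      have "k' i < 2 * 2 ^ N i" using k'(1) by (auto simp: mem_grid dest: spec[of _ i])
      moreover have "k' j < 2 ^ N j" if "j \<noteq> i" for j
        using k'(1)[unfolded mem_grid, rule_format, of j] that by simp
      ultimately show "k \<in> grid N" by (auto simp: mem_grid k_def)
      show "x \<in> cell N k" unfolding mem_cell_iff using yi2(1) yj unfolding y_def by metis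
    qed
    have "L x = c k * (\<Prod>j\<in>UNIV. if j = i then indicator {0<..<1} (2 * y k x j) - indicator {0<..<1} (2 * y k x j - 1) else indicator {0<..<1} (y k x j))"
      unfolding L_def
    proof (rule sum_grid_on_cell[OF k])
      fix l assume "x \<notin> cell N l"
      then obtain j where "y l x j \<notin> {0<..<1}" unfolding mem_cell_iff y_def by blast
      then have "(if j = i then indicator {0<..<1} (2 * y l x j) - indicator {0<..<1} (2 * y l x j - 1) else indicator {0<..<1} (y l x j)) = (0::real)"
        by (auto simp: indicator_def)
      then show "c l * (\<Prod>j\<in>UNIV. if j = i then indicator {0<..<1} (2 * y l x j) - indicator {0<..<1} (2 * y l x j - 1) else indicator {0<..<1} (y l x j)) = 0"
        by (subst prod_zero) (auto intro!: exI[of _ j])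
    qed
    also have "(\<Prod>j\<in>UNIV. if j = i then indicator {0<..<1} (2 * y k x j) - indicator {0<..<1} (2 * y k x j - 1) else indicator {0<..<1} (y k x j))
       = (\<Prod>j\<in>UNIV. if j = i then (if k' i = 2 * k i then 1 else (-1::real)) else 1)"
      using yi2(2) yj by (intro prod.cong) auto
    also have "\<dots> = (if k' i = 2 * k i then 1 else -1)" by simp
    finally have Lx: "L x = c k * (if k' i = 2 * k i then 1 else -1)" .
    have "sum ?N UNIV = Suc (sum N UNIV)"
      by (subst (1 2) sum.remove[of _ i]) auto
    then have "cell_density f ?N x = 2 * 2 ^ sum N UNIV * cell_increment f ?N k'"
      by (simp add: cell_density_on_cell[OF k'])
    moreover have "cell_density f N x = 2 ^ sum N UNIV * (cell_increment f ?N (k(i := 2 * k i)) + cell_increment f ?N (k(i := 2 * k i + 1)))"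
      by (simp add: cell_density_on_cell[OF k] cell_increment_split[of f N k i])
    ultimately show ?thesis using e Lx by (auto simp: c_def algebra_simps)
  qed
  have ui: "integrable lebesgue u" and u0: "AE x in lebesgue. x \<notin> unit_cube \<longrightarrow> u x = 0"
    using u by (auto simp: BV_cube_def)
  have um[measurable]: "u \<in> borel_measurable lebesgue" using ui by auto
  have Dm[measurable]: "D m \<in> borel_measurable lebesgue" for m
  proof -
    have [measurable]: "bump m \<in> borel_measurable borel" by (intro borel_measurable_continuous_onI continuous_bump)
    have "D m \<in> borel_measurable borel" unfolding D_def[abs_def] y_def by measurable
    then show ?thesis by (simp add: measurable_completion)
  qed
  have Lm[measurable]: "L \<in> borel_measurable lebesgue"
    by (rule borel_measurable_LIMSEQ_real[OF lim]) measurable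
  have "T_functional (cell_density f ?N) u - T_functional (cell_density f N) u = (\<integral>x. cell_density f ?N x * u x - cell_density f N x * u x \<partial>lebesgue)"
    unfolding T_functional_cell_density_eq[OF u0 ui]
    by (rule Bochner_Integration.integral_diff[symmetric]) (intro integrable_cell_density_mult ui)+
  also have "\<dots> = (\<integral>x. u x * L x \<partial>lebesgue)"
  proof (rule integral_cong_AE)
    show "AE x in lebesgue. cell_density f ?N x * u x - cell_density f N x * u x = u x * L x"
      using u0 AE_irrational
    proof eventually_elim
      case (elim x)
      then show ?case by (cases "x \<in> unit_cube") (auto simp: L_eq algebra_simps)
    qed
    show "(\<lambda>x. cell_density f ?N x * u x - cell_density f N x * u x) \<in> borel_measurable lebesgue"
      by (intro borel_measurable_diff borel_measurable_integrable integrable_cell_density_mult ui)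
  qed measurable
  finally have diff: "T_functional (cell_density f ?N) u - T_functional (cell_density f N) u = (\<integral>x. u x * L x \<partial>lebesgue)" .
  have "(\<lambda>m. \<integral>x. u x * D m x \<partial>lebesgue) \<longlonglongrightarrow> (\<integral>x. u x * L x \<partial>lebesgue)"
  proof (rule integral_dominated_convergence[where w = "\<lambda>x. (\<Sum>k\<in>grid N. \<bar>c k\<bar>) * \<bar>u x\<bar>"])
    show "AE x in lebesgue. (\<lambda>m. u x * D m x) \<longlonglongrightarrow> u x * L x" by (intro AE_I2 tendsto_mult_left lim)
    show "AE x in lebesgue. norm (u x * D m x) \<le> (\<Sum>k\<in>grid N. \<bar>c k\<bar>) * \<bar>u x\<bar>" for m
      by (intro AE_I2) (simp add: abs_mult mult.commute[of "\<bar>u _\<bar>"] mult_right_mono D_bound)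
    show "integrable lebesgue (\<lambda>x. (\<Sum>k\<in>grid N. \<bar>c k\<bar>) * \<bar>u x\<bar>)" using ui by auto
  qed measurable
  then have "(\<lambda>m. \<bar>\<integral>x. u x * D m x \<partial>lebesgue\<bar>) \<longlonglongrightarrow> \<bar>\<integral>x. u x * L x \<partial>lebesgue\<bar>"
    by (rule tendsto_rabs)
  then have "\<bar>\<integral>x. u x * L x \<partial>lebesgue\<bar> \<le> 2 ^ sum N UNIV * b / 2 ^ N i * enn2real (gradient_variation u)"
  proof (rule LIMSEQ_le_const2, intro exI allI impI)
    fix m
    show "\<bar>\<integral>x. u x * D m x \<partial>lebesgue\<bar> \<le> 2 ^ sum N UNIV * b / 2 ^ N i * enn2real (gradient_variation u)"
      using BV_partial_deriv_bound[OF u test[of m] \<phi>_bound, of i] by (simp add: D)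
  qed
  then show ?thesis by (simp add: diff)
qed

section \<open>The limit functional\<close>

lemma geometric_increments_convergent:
  fixes a :: "nat \<Rightarrow> real"
  assumes r: "0 \<le> r" "r < 1" and a: "\<And>n. \<bar>a (Suc n) - a n\<bar> \<le> K * r ^ n"
  shows "convergent a" "\<bar>lim a - a n\<bar> \<le> K / (1 - r) * r ^ n"
proof -
  have K: "0 \<le> K" using a[of 0] by simp
  have "summable (\<lambda>n. a (Suc n) - a n)"
    by (rule summable_comparison_test'[of "\<lambda>n. K * r ^ n" 0])
       (use r a in \<open>auto intro!: summable_mult summable_geometric\<close>)
  then have "convergent (\<lambda>n. \<Sum>i<n. a (Suc i) - a i)"
    by (simp add: summable_iff_convergent)
  then have "convergent (\<lambda>n. (a n - a 0) + a 0)"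
    unfolding sum_lessThan_telescope by (intro convergent_add convergent_const)
  then show conv: "convergent a" by simp
  have *: "\<bar>a (n + m) - a n\<bar> \<le> K / (1 - r) * r ^ n * (1 - r ^ m)" for m
  proof (induction m)
    case (Suc m)
    have "\<bar>a (n + Suc m) - a n\<bar> \<le> K * r ^ (n + m) + K / (1 - r) * r ^ n * (1 - r ^ m)"
      using a[of "n + m"] Suc by simp
    also have "\<dots> = K / (1 - r) * r ^ n * (1 - r ^ Suc m)"
      using r by (simp add: field_simps power_add)
    finally show ?case .
  qed simp
  have "\<bar>a (n + m) - a n\<bar> \<le> K / (1 - r) * r ^ n" for m
  proof (rule order_trans[OF *])
    show "K / (1 - r) * r ^ n * (1 - r ^ m) \<le> K / (1 - r) * r ^ n"
      using r K by (intro mult_left_le) (auto intro!: mult_nonneg_nonneg divide_nonneg_nonneg)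
  qed
  moreover have "(\<lambda>m. \<bar>a (n + m) - a n\<bar>) \<longlonglongrightarrow> \<bar>lim a - a n\<bar>"
  proof -
    have "(\<lambda>m. a (m + n)) \<longlonglongrightarrow> lim a" using conv by (simp add: LIMSEQ_ignore_initial_segment convergent_LIMSEQ_iff)
    then show ?thesis by (auto intro!: tendsto_intros simp: add.commute)
  qed
  ultimately show "\<bar>lim a - a n\<bar> \<le> K / (1 - r) * r ^ n"
    by (intro LIMSEQ_le_const2) auto
qed

lemma cell_density_Ld_cube: "cell_density f N \<in> Ld_cube"
proof -
  obtain B where B: "\<And>x. \<bar>cell_density f N x\<bar> \<le> B" "B \<ge> 0" using bounded_cell_density[of f N] by blast
  have m[measurable]: "cell_density f N \<in> borel_measurable lebesgue"
    using cell_density_measurable by (simp add: measurable_completion)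
  have "set_borel_measurable lebesgue unit_cube (cell_density f N)"
    unfolding set_borel_measurable_def
    by (intro borel_measurable_scaleR borel_measurable_indicator m) auto
  moreover have "set_integrable lebesgue unit_cube (\<lambda>x. \<bar>cell_density f N x\<bar> ^ CARD('a))"
    unfolding set_integrable_def
  proof (rule Bochner_Integration.integrable_bound)
    show "integrable lebesgue (\<lambda>x::real^'a. B ^ CARD('a) * indicator unit_cube x :: real)"
      by (auto intro!: integrable_mult_right integrable_real_indicator simp: emeasure_lborel_cbox_eq)
    have "(\<lambda>x. \<bar>cell_density f N x\<bar> ^ CARD('a)) \<in> borel_measurable lebesgue" by measurable
    then show "(\<lambda>x. indicator unit_cube x *\<^sub>R \<bar>cell_density f N x\<bar> ^ CARD('a)) \<in> borel_measurable lebesgue"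
      by (intro borel_measurable_scaleR borel_measurable_indicator) auto
    show "AE x in lebesgue. norm (indicator unit_cube x *\<^sub>R \<bar>cell_density f N x\<bar> ^ CARD('a)) \<le> norm (B ^ CARD('a) * indicator unit_cube x)"
      using B by (auto simp: indicator_def intro!: power_mono)
  qed
  ultimately show ?thesis by (simp add: Ld_cube_def)
qed

text \<open>With \<open>q = 2 powr (- d \<gamma>)\<close> the assumptions say that the increments over dyadic cubes are
  \<open>\<gamma>\<close>-Hoelder and that \<open>\<gamma> > (d - 1) / d\<close>.\<close>

locale holder_increments =
  fixes f :: "real^'n \<Rightarrow> real" and C q :: real
  assumes C: "0 \<le> C" and q: "0 < q" "2 ^ CARD('n) * q < 2"
    and cube_bound: "\<And>n k. k \<in> grid (\<lambda>_. n) \<Longrightarrow> \<bar>cell_increment f (\<lambda>_. n) k\<bar> \<le> C * q ^ n"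
begin

text \<open>The geometric rate of convergence of the densities: a factor \<open>2\<^sup>d\<close> for the inverse volume, \<open>q\<close> for
  the increment, and \<open>1/2\<close> gained from the height of the tents.\<close>

definition ratio :: real where "ratio = 2 ^ CARD('n) * q / 2"

text \<open>The intermediate grids between generations \<open>n\<close> and \<open>n + 1\<close>: the coordinates in \<open>S\<close> are already
  refined.\<close>

definition level :: "nat \<Rightarrow> 'n set \<Rightarrow> 'n \<Rightarrow> nat" where "level n S j = (if j \<in> S then Suc n else n)"

abbreviation T :: "nat \<Rightarrow> (real^'n \<Rightarrow> real) \<Rightarrow> real" where
  "T n \<equiv> T_functional (cell_density f (\<lambda>_. n))"

lemma ratio_bounds: "0 \<le> ratio" "ratio < 1"
  using q by (auto simp: ratio_def)

text \<open>A cell whose coordinates in \<open>S\<close> are still coarse is a union of \<open>2\<^sup>|\<^sup>S\<^sup>|\<close> cubes of generation \<open>n + 1\<close>;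
  the induction halves it once for each element of \<open>S\<close>.\<close>

lemma mixed_cell_bound_aux:
  assumes "k \<in> grid (level n (- S))"
  shows "\<bar>cell_increment f (level n (- S)) k\<bar> \<le> 2 ^ card S * (C * q ^ Suc n)"
  using finite[of S] assms
proof (induction S arbitrary: k rule: finite_induct)
  case empty
  have "level n (- {}) = (\<lambda>_. Suc n)" by (auto simp: level_def)
  then show ?case using cube_bound[of k "Suc n"] empty by simp
next
  case (insert i S)
  let ?N = "level n (- insert i S)"
  have N: "?N(i := Suc (?N i)) = level n (- S)" using insert(2) by (auto simp: level_def)
  have "\<bar>cell_increment f (level n (- S)) (k(i := 2 * k i))\<bar> \<le> 2 ^ card S * (C * q ^ Suc n)"
    using grid_refine(1)[OF insert.prems, of i] unfolding N by (rule insert.IH)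
  moreover have "\<bar>cell_increment f (level n (- S)) (k(i := 2 * k i + 1))\<bar> \<le> 2 ^ card S * (C * q ^ Suc n)"
    using grid_refine(2)[OF insert.prems, of i] unfolding N by (rule insert.IH)
  moreover have "cell_increment f ?N k = cell_increment f (level n (- S)) (k(i := 2 * k i)) + cell_increment f (level n (- S)) (k(i := 2 * k i + 1))"
    using cell_increment_split[of f ?N k i] unfolding N .
  moreover have "(2::real) ^ card (insert i S) = 2 * 2 ^ card S" using insert(1,2) by simp
  ultimately show ?case by (simp del: power_Suc)
qed

lemma mixed_cell_bound:
  assumes "k \<in> grid (level n S)"
  shows "\<bar>cell_increment f (level n S) k\<bar> \<le> 2 ^ CARD('n) * (C * q ^ Suc n)"
proof -
  have "\<bar>cell_increment f (level n S) k\<bar> \<le> 2 ^ card (- S) * (C * q ^ Suc n)"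
    using mixed_cell_bound_aux[of k n "- S"] assms by simp
  also have "\<dots> \<le> 2 ^ CARD('n) * (C * q ^ Suc n)"
    using C q by (intro mult_right_mono power_increasing card_mono) auto
  finally show ?thesis .
qed

definition norm_const :: real where "norm_const = real CARD('n) * (2 ^ CARD('n) * 2 ^ CARD('n) * C * q)"

lemma norm_const_nonneg: "0 \<le> norm_const" using C q by (simp add: norm_const_def)

text \<open>Refine one coordinate after the other; each of the \<open>d\<close> refinements satisfies
  \<open>cell_density_refine_bound\<close>.\<close>

lemma T_Suc_diff:
  assumes u: "u \<in> BV_cube"
  shows "\<bar>T (Suc n) u - T n u\<bar> \<le> norm_const * enn2real (gradient_variation u) * ratio ^ n"
proof -
  let ?V = "enn2real (gradient_variation u)"
  let ?c = "2 ^ CARD('n) * 2 ^ CARD('n) * C * q * ratio ^ n * ?V"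
  have "\<bar>T_functional (cell_density f (level n S)) u - T n u\<bar> \<le> real (card S) * ?c" for S
    using finite[of S]
  proof (induction S rule: finite_induct)
    case empty
    have "level n {} = (\<lambda>_. n)" by (auto simp: level_def)
    then show ?case by simp
  next
    case (insert i S)
    let ?N = "level n S"
    have N: "?N i = n" "?N(i := Suc n) = level n (insert i S)" using insert(2) by (auto simp: level_def)
    have le: "sum ?N UNIV \<le> CARD('n) * Suc n"
      using sum_bounded_above[of UNIV ?N "Suc n"] by (simp add: level_def)
    have "\<bar>T_functional (cell_density f (level n (insert i S))) u - T_functional (cell_density f ?N) u\<bar>
       \<le> 2 ^ sum ?N UNIV * (2 ^ CARD('n) * (C * q ^ Suc n)) / 2 ^ n * ?V"
      using cell_density_refine_bound[OF u, of ?N i f "2 ^ CARD('n) * (C * q ^ Suc n)"] mixed_cell_bound[of _ n "insert i S"]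
      unfolding N by blast
    also have "\<dots> \<le> 2 ^ (CARD('n) * Suc n) * (2 ^ CARD('n) * (C * q ^ Suc n)) / 2 ^ n * ?V"
      using C q le by (intro mult_right_mono divide_right_mono power_increasing) auto
    also have "\<dots> = ?c"
      unfolding power_mult ratio_def by (simp add: power_mult_distrib power_divide)
    finally show ?case using insert by (simp add: distrib_right)
  qed
  from this[of UNIV] have "\<bar>T_functional (cell_density f (level n UNIV)) u - T n u\<bar> \<le> real CARD('n) * ?c" .
  moreover have "level n UNIV = (\<lambda>_. Suc n)" by (auto simp: level_def)
  ultimately show ?thesis by (simp add: norm_const_def mult_ac)
qed

definition limit_functional :: "(real^'n \<Rightarrow> real) \<Rightarrow> real" where "limit_functional u = lim (\<lambda>n. T n u)"

lemma T_LIMSEQ: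
  assumes "u \<in> BV_cube" shows "(\<lambda>n. T n u) \<longlonglongrightarrow> limit_functional u"
  using geometric_increments_convergent(1)[OF ratio_bounds T_Suc_diff[OF assms]]
  by (simp add: limit_functional_def convergent_LIMSEQ_iff)

lemma gradient_variation_le_BV_norm: "enn2real (gradient_variation u) \<le> BV_norm u"
  unfolding BV_norm_def by simp

lemma limit_functional_T_diff:
  assumes "u \<in> BV_cube" shows "\<bar>limit_functional u - T n u\<bar> \<le> norm_const / (1 - ratio) * ratio ^ n * BV_norm u"
proof -
  have "\<bar>limit_functional u - T n u\<bar> \<le> norm_const * enn2real (gradient_variation u) / (1 - ratio) * ratio ^ n"
    using geometric_increments_convergent(2)[OF ratio_bounds T_Suc_diff[OF assms]] by (simp add: limit_functional_def)
  also have "\<dots> = norm_const / (1 - ratio) * ratio ^ n * enn2real (gradient_variation u)" by simp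
  also have "\<dots> \<le> norm_const / (1 - ratio) * ratio ^ n * BV_norm u"
    using norm_const_nonneg ratio_bounds by (intro mult_left_mono gradient_variation_le_BV_norm) auto
  finally show ?thesis .
qed

lemma BV_cubeD:
  assumes "u \<in> BV_cube"
  shows "integrable lebesgue u" "AE x in lebesgue. x \<notin> unit_cube \<longrightarrow> u x = 0"
  using assms by (auto simp: BV_cube_def)

lemma T_add:
  assumes "integrable lebesgue u" "AE x in lebesgue. x \<notin> unit_cube \<longrightarrow> u x = 0"
    and "integrable lebesgue v" "AE x in lebesgue. x \<notin> unit_cube \<longrightarrow> v x = 0"
  shows "T n (\<lambda>x. u x + v x) = T n u + T n v"
proof -
  have uv: "AE x in lebesgue. x \<notin> unit_cube \<longrightarrow> u x + v x = 0"
    using assms(2,4) by eventually_elim auto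
  show ?thesis
    by (simp add: T_functional_cell_density_eq assms uv distrib_left integrable_cell_density_mult)
qed

lemma T_cmult: 
  assumes "integrable lebesgue u" "AE x in lebesgue. x \<notin> unit_cube \<longrightarrow> u x = 0"
  shows "T n (\<lambda>x. c * u x) = c * T n u"
proof -
  have cu: "AE x in lebesgue. x \<notin> unit_cube \<longrightarrow> c * u x = 0"
    using assms(2) by eventually_elim auto
  have "T n (\<lambda>x. c * u x) = (\<integral>x. c * (cell_density f (\<lambda>_. n) x * u x) \<partial>lebesgue)"
    using assms(1) by (subst T_functional_cell_density_eq[OF cu]) (simp_all add: mult.left_commute)
  also have "\<dots> = c * T n u" by (simp add: T_functional_cell_density_eq assms)
  finally show ?thesis .
qed

lemma limit_functional_BV_dual: "limit_functional \<in> BV_dual"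
  unfolding BV_dual_def
proof (intro CollectI conjI ballI allI)
  fix u v :: "real^'n \<Rightarrow> real" assume uv: "u \<in> BV_cube" "v \<in> BV_cube"
  have "(\<lambda>n. T n u + T n v) \<longlonglongrightarrow> limit_functional u + limit_functional v"
    by (intro tendsto_add T_LIMSEQ uv)
  then show "limit_functional (\<lambda>x. u x + v x) = limit_functional u + limit_functional v"
    unfolding T_add[OF BV_cubeD[OF uv(1)] BV_cubeD[OF uv(2)], symmetric] 
    by (simp add: limit_functional_def[of "\<lambda>x. u x + v x"] limI)
next
  fix c and u :: "real^'n \<Rightarrow> real" assume u: "u \<in> BV_cube"
  have "(\<lambda>n. c * T n u) \<longlonglongrightarrow> c * limit_functional u"
    by (intro tendsto_mult_left T_LIMSEQ u)
  then show "limit_functional (\<lambda>x. c * u x) = c * limit_functional u"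
    unfolding T_cmult[OF BV_cubeD[OF u], symmetric] 
    by (simp add: limit_functional_def[of "\<lambda>x. c * u x"] limI)
next
  obtain B where B: "\<And>x. \<bar>cell_density f (\<lambda>_. 0) x\<bar> \<le> B" "B \<ge> 0" using bounded_cell_density[of f "\<lambda>_. 0"] by blast
  have "\<bar>limit_functional u\<bar> \<le> (norm_const / (1 - ratio) + B) * BV_norm u" if u: "u \<in> BV_cube" for u
  proof -
    note ui = BV_cubeD[OF u]
    have "\<bar>T 0 u\<bar> \<le> (\<integral>x. \<bar>cell_density f (\<lambda>_. 0) x * u x\<bar> \<partial>lebesgue)"
      unfolding T_functional_cell_density_eq[OF ui(2,1)] by (rule integral_abs_bound)
    also have "\<dots> \<le> (\<integral>x. B * \<bar>u x\<bar> \<partial>lebesgue)"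
      by (intro integral_mono integrable_abs integrable_cell_density_mult ui integrable_mult_right)
         (auto simp: abs_mult intro!: mult_right_mono B)
    also have "\<dots> \<le> B * BV_norm u"
      using B(2) by (auto simp: BV_norm_def intro!: mult_left_mono)
    finally show ?thesis
      using limit_functional_T_diff[OF u, of 0] by (simp add: distrib_right)
  qed
  then show "\<exists>K. \<forall>u\<in>BV_cube. \<bar>limit_functional u\<bar> \<le> K * BV_norm u" by blast
qed

lemma limit_functional_SCH: "limit_functional \<in> SCH"
  unfolding SCH_def
proof (intro CollectI conjI allI impI limit_functional_BV_dual)
  fix e :: real assume e: "e > 0"
  have "(\<lambda>n. norm_const / (1 - ratio) * ratio ^ n) \<longlonglongrightarrow> norm_const / (1 - ratio) * 0"
    using ratio_bounds by (intro tendsto_mult_left LIMSEQ_power_zero) auto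
  then have "eventually (\<lambda>n. norm_const / (1 - ratio) * ratio ^ n < e) sequentially"
    using e by (intro order_tendstoD(2)[of _ 0]) auto
  then obtain n where n: "norm_const / (1 - ratio) * ratio ^ n < e" by (auto simp: eventually_sequentially)
  have "\<bar>limit_functional u - T n u\<bar> \<le> e * BV_norm u" if u: "u \<in> BV_cube" for u
  proof -
    have "0 \<le> BV_norm u" by (simp add: BV_norm_def)
    then show ?thesis using limit_functional_T_diff[OF u, of n] n mult_right_mono[of "norm_const / (1 - ratio) * ratio ^ n" e "BV_norm u"] by linarith
  qed
  then show "\<exists>g\<in>Ld_cube. \<forall>u\<in>BV_cube. \<bar>limit_functional u - T_functional g u\<bar> \<le> e * BV_norm u"
    using cell_density_Ld_cube by blast
qed

end

section \<open>Values of the limit on boxes\<close>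

lemma T_functional_indicator:
  assumes "K \<in> sets lebesgue" "K \<subseteq> unit_cube"
  shows "integrable lebesgue (indicator K :: _ \<Rightarrow> real)" "AE x in lebesgue. x \<notin> unit_cube \<longrightarrow> (indicator K x :: real) = 0"
proof -
  have "K \<in> lmeasurable"
    using assms bounded_subset[OF bounded_cbox] by (intro bounded_set_imp_lmeasurable) auto
  then show "integrable lebesgue (indicator K :: _ \<Rightarrow> real)"
    by (auto simp: fmeasurable_def less_top[symmetric] intro!: integrable_real_indicator)
  show "AE x in lebesgue. x \<notin> unit_cube \<longrightarrow> (indicator K x :: real) = 0"
    using assms(2) by (auto simp: indicator_def)
qed

lemma measure_cell: "measure lebesgue (cell N k) = 1 / 2 ^ sum N UNIV"
proof -
  have le: "\<forall>i. grid_point N k $ i \<le> grid_point N (\<lambda>j. k j + 1) $ i" by (simp add: divide_right_mono)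
  then have ne: "cbox (grid_point N k) (grid_point N (\<lambda>j. k j + 1)) \<noteq> {}"
    unfolding interval_ne_empty_cart .
  have "measure lebesgue (cell N k) = measure lborel (cbox (grid_point N k) (grid_point N (\<lambda>j. k j + 1)))"
    unfolding cell_def by (simp add: measure_lborel_box_eq measure_lborel_cbox_eq)
  also have "\<dots> = (\<Prod>i\<in>UNIV. 1 / 2 ^ N i)"
    by (subst content_cbox_cart[OF ne]) (simp add: diff_divide_distrib[symmetric])
  finally show ?thesis by (simp add: prod_dividef power_sum)
qed

text \<open>A box with corners on the grid is, up to a null set, the union of the cells it contains; the integral
  over each of them is the increment over that cell.\<close>

lemma T_functional_cell_density_grid_box:
  assumes pq: "\<And>j. p j \<le> q j" "\<And>j. q j \<le> 2 ^ N j"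
  shows "T_functional (cell_density f N) (indicator (cbox (grid_point N p) (grid_point N q))) = box_increment f (grid_point N p) (grid_point N q)"
proof -
  let ?K = "cbox (grid_point N p) (grid_point N q)"
  have sub: "?K \<subseteq> unit_cube"
  proof
    fix x assume x: "x \<in> ?K"
    have "0 \<le> x$j \<and> x$j \<le> 1" for j
    proof -
      have "real (p j) / 2 ^ N j \<le> x$j" "x$j \<le> real (q j) / 2 ^ N j" using x by (auto simp: mem_box_cart)
      moreover have "real (q j) / 2 ^ N j \<le> 1" using pq(2)[of j] of_nat_mono[of "q j" "2 ^ N j", where 'a=real] by simp
      moreover have "0 \<le> real (p j) / 2 ^ N j" by simp
      ultimately show ?thesis by linarith
    qed
    then show "x \<in> unit_cube" by (simp add: mem_box_cart)
  qed
  have cell_K: "cell N k \<inter> ?K = (if k \<in> PiE UNIV (\<lambda>j. {p j..<q j}) then cell N k else {})" for k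
  proof (cases "k \<in> PiE UNIV (\<lambda>j. {p j..<q j})")
    case True
    then have k: "p j \<le> k j" "k j + 1 \<le> q j" for j by (auto simp: PiE_iff Suc_le_eq)
    have "x \<in> ?K" if x: "x \<in> cell N k" for x
    proof -
      have "real (p j) / 2 ^ N j \<le> x$j \<and> x$j \<le> real (q j) / 2 ^ N j" for j
      proof -
        have "real (k j) < 2 ^ N j * x$j" "2 ^ N j * x$j < real (k j) + 1"
          using x[unfolded mem_cell_iff] by (auto dest!: spec[of _ j])
        moreover have "real (p j) \<le> real (k j)" "real (k j) + 1 \<le> real (q j)" using k[of j] by linarith+
        ultimately have "real (p j) \<le> 2 ^ N j * x$j" "2 ^ N j * x$j \<le> real (q j)" by linarith+
        then show ?thesis by (simp add: field_simps)
      qed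
      then show ?thesis by (simp add: mem_box_cart)
    qed
    then show ?thesis using True by auto
  next
    case False
    have "k \<in> PiE UNIV (\<lambda>j. {p j..<q j})" if x: "x \<in> cell N k" "x \<in> ?K" for x
    proof -
      have "p j \<le> k j \<and> k j < q j" for j
      proof -
        have "real (k j) < 2 ^ N j * x$j" "2 ^ N j * x$j < real (k j) + 1"
          using x(1)[unfolded mem_cell_iff] by (auto dest!: spec[of _ j])
        moreover have "real (p j) / 2 ^ N j \<le> x$j" "x$j \<le> real (q j) / 2 ^ N j" using x(2) by (auto simp: mem_box_cart)
        then have "real (p j) \<le> 2 ^ N j * x$j" "2 ^ N j * x$j \<le> real (q j)" by (simp_all add: field_simps)
        ultimately show ?thesis by linarith
      qed
      then show ?thesis by (simp add: PiE_iff)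
    qed
    then show ?thesis using False by auto
  qed
  have sub_grid: "PiE UNIV (\<lambda>j. {p j..<q j}) \<subseteq> grid N"
    using less_le_trans[OF _ pq(2)] by (auto simp: mem_grid PiE_iff)
  have meas: "cell N k \<inter> ?K \<in> sets lebesgue" for k
    unfolding cell_def by (intro sets.Int) auto
  have sub': "cell N k \<inter> ?K \<subseteq> unit_cube" for k using sub by blast
  note ind = T_functional_indicator[OF meas sub']
  have "T_functional (cell_density f N) (indicator ?K) = (\<integral>x. cell_density f N x * indicator ?K x \<partial>lebesgue)"
    by (rule T_functional_cell_density_eq) (use T_functional_indicator[OF _ sub] in auto)
  also have "\<dots> = (\<integral>x. (\<Sum>k\<in>grid N. 2 ^ sum N UNIV * cell_increment f N k * indicator (cell N k \<inter> ?K) x) \<partial>lebesgue)"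
    unfolding cell_density_def sum_distrib_right by (simp add: indicator_inter_arith mult_ac)
  also have "\<dots> = (\<Sum>k\<in>grid N. 2 ^ sum N UNIV * cell_increment f N k * measure lebesgue (cell N k \<inter> ?K))"
    by (subst Bochner_Integration.integral_sum) (auto intro!: ind(1) integrable_mult_right)
  also have "\<dots> = (\<Sum>k\<in>grid N. if k \<in> PiE UNIV (\<lambda>j. {p j..<q j}) then cell_increment f N k else 0)"
    unfolding cell_K by (intro sum.cong) (auto simp: measure_cell)
  also have "\<dots> = (\<Sum>k\<in>PiE UNIV (\<lambda>j. {p j..<q j}). cell_increment f N k)"
    using sub_grid by (subst sum.inter_restrict[symmetric]) (auto simp: Int_absorb1)
  also have "\<dots> = box_increment f (grid_point N p) (grid_point N q)"
    using box_increment_eq_sum_cells[of p q f N] pq(1) by simp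
  finally show ?thesis .
qed

lemma measure_box_diff_le:
  fixes a b a' b' :: "real^'n"
  assumes "cbox a b \<subseteq> unit_cube" "cbox a' b' \<subseteq> unit_cube" "\<And>i. a$i \<le> b$i" "\<And>i. a'$i \<le> b'$i"
    and "\<And>i. \<bar>(b'$i - a'$i) - (b$i - a$i)\<bar> \<le> e"
  shows "\<bar>measure lebesgue (cbox a' b') - measure lebesgue (cbox a b)\<bar> \<le> real CARD('n) * e"
proof -
  have m: "measure lborel (cbox c d) = (\<Prod>i\<in>UNIV. d$i - c$i)" if "\<And>i. c$i \<le> d$i" for c d :: "real^'n"
    using content_cbox_cart[of c d] that by (simp add: interval_ne_empty_cart)
  have le1: "\<bar>d$i - c$i\<bar> \<le> 1" if c: "cbox c d \<subseteq> unit_cube" "\<And>i. c$i \<le> d$i" for c d :: "real^'n" and i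
  proof -
    have "c \<in> cbox c d" "d \<in> cbox c d" using c(2) by (auto simp: mem_box_cart)
    then have "c \<in> unit_cube" "d \<in> unit_cube" using c(1) by auto
    then have "0 \<le> c$i" "d$i \<le> 1" by (auto simp: mem_box_cart)
    then show ?thesis using c(2)[of i] by linarith
  qed
  have "norm ((\<Prod>i\<in>UNIV. b'$i - a'$i) - (\<Prod>i\<in>UNIV. b$i - a$i)) \<le> (\<Sum>i\<in>UNIV. norm ((b'$i - a'$i) - (b$i - a$i)))"
    by (rule norm_prod_diff) (use le1[of a b] le1[of a' b'] assms in auto)
  also have "\<dots> \<le> (\<Sum>i\<in>(UNIV::'n set). e)"
    by (rule sum_mono) (use assms(5) in auto)
  finally show ?thesis using assms by (simp add: m)
qed

context holder_increments
begin

text \<open>Replace the box by the box \<open>cbox (P n) (Q n)\<close> with corners rounded down to the grid. There the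
  integral is the increment, which converges by continuity of \<open>f\<close>. The symmetric difference has volume
  of order \<open>2\<^sup>-\<^sup>n\<close> and the density is at most of order \<open>(2\<^sup>d q)\<^sup>n\<close>, so the error is of order \<open>ratio\<^sup>n\<close>.\<close>

lemma T_indicator_tendsto_increment:
  assumes cont: "continuous_on unit_cube f"
    and ab: "\<And>i. a$i < b$i" and sub: "cbox a b \<subseteq> unit_cube"
  shows "(\<lambda>n. T n (indicator (cbox a b))) \<longlonglongrightarrow> box_increment f a b"
proof -
  define p where "p n j = nat \<lfloor>2 ^ n * a$j\<rfloor>" for n :: nat and j
  define s where "s n j = nat \<lfloor>2 ^ n * b$j\<rfloor>" for n :: nat and j
  define P where "P n = grid_point (\<lambda>_. n) (p n)" for n
  define Q where "Q n = grid_point (\<lambda>_. n) (s n)" for n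
  have ab01: "0 \<le> a$j" "b$j \<le> 1" for j
  proof -
    have "a \<in> cbox a b" "b \<in> cbox a b" using ab by (auto simp: mem_box_cart less_imp_le)
    then have "a \<in> unit_cube" "b \<in> unit_cube" using sub by auto
    then show "0 \<le> a$j" "b$j \<le> 1" by (auto simp: mem_box_cart)
  qed
  have round: "real (nat \<lfloor>2 ^ n * t\<rfloor>) / 2 ^ n \<le> t" "t < real (nat \<lfloor>2 ^ n * t\<rfloor>) / 2 ^ n + 1 / 2 ^ n" if "0 \<le> t"
    for t :: real and n :: nat
  proof -
    have "real (nat \<lfloor>2 ^ n * t\<rfloor>) = of_int \<lfloor>2 ^ n * t\<rfloor>" using that by simp
    then have "real (nat \<lfloor>2 ^ n * t\<rfloor>) \<le> 2 ^ n * t" "2 ^ n * t < real (nat \<lfloor>2 ^ n * t\<rfloor>) + 1" by linarith+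
    then show "real (nat \<lfloor>2 ^ n * t\<rfloor>) / 2 ^ n \<le> t" "t < real (nat \<lfloor>2 ^ n * t\<rfloor>) / 2 ^ n + 1 / 2 ^ n" 
      by (simp_all add: field_simps)
  qed
  have P: "0 \<le> P n $ j" "P n $ j \<le> a$j" "a$j < P n $ j + 1 / 2 ^ n" for n j
    using round[of "a$j" n] ab01(1)[of j] by (simp_all add: P_def p_def)
  have Q: "Q n $ j \<le> b$j" "b$j < Q n $ j + 1 / 2 ^ n" for n j
    using round[of "b$j" n] ab01(1)[of j] ab[of j] by (simp_all add: Q_def s_def)
  have ps: "p n j \<le> s n j" for n j
    unfolding p_def s_def using ab[of j] by (intro nat_mono floor_mono mult_left_mono) auto
  have PQ: "P n $ j \<le> Q n $ j" for n j
    using ps[of n j] by (simp add: P_def Q_def divide_right_mono)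
  have s1: "s n j \<le> 2 ^ n" for n j
  proof -
    have "real (s n j) / 2 ^ n \<le> 1" using Q(1)[of n j] ab01(2)[of j] unfolding Q_def grid_point_nth by linarith
    then have "real (s n j) \<le> 2 ^ n" by simp
    then show ?thesis using of_nat_le_iff[of "s n j" "2 ^ n", where 'a=real] by simp
  qed
  have T_eq: "T n (indicator (cbox (P n) (Q n))) = box_increment f (P n) (Q n)" for n
    unfolding P_def Q_def by (rule T_functional_cell_density_grid_box) (use ps s1 in auto)
  have subs: "cbox (P n) (Q n) \<subseteq> unit_cube" "cbox (P n) b \<subseteq> unit_cube" for n
    using P(1)[of n] order_trans[OF Q(1)[of n] ab01(2)] ab01(2) by (auto intro!: subset_interval_imp_cart)
  have density_le: "\<bar>cell_density f (\<lambda>_. n) x\<bar> \<le> (2 ^ CARD('n) * q) ^ n * C" for n x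
  proof -
    have "\<bar>cell_density f (\<lambda>_. n) x\<bar> \<le> 2 ^ sum (\<lambda>_. n) (UNIV::'n set) * (C * q ^ n)"
      by (rule abs_cell_density_le) (use cube_bound C q in auto)
    also have "(2::real) ^ sum (\<lambda>_. n) (UNIV::'n set) = (2 ^ CARD('n)) ^ n"
      by (simp add: power_mult[symmetric] mult.commute)
    finally show ?thesis by (simp add: power_mult_distrib mult_ac)
  qed
  have diff: "\<bar>T n (indicator (cbox a b)) - T n (indicator (cbox (P n) (Q n)))\<bar> \<le> 2 * real CARD('n) * C * ratio ^ n" for n
  proof -
    \<comment> \<open>\<open>?M\<close> contains both boxes and exceeds each of them by a volume of at most \<open>d \<cdot> 2\<^sup>-\<^sup>n\<close>.\<close>
    let ?M = "cbox (P n) b"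
    let ?i = "\<lambda>K x. indicator K x :: real"
    have K1: "cbox a b \<subseteq> ?M" "cbox (P n) (Q n) \<subseteq> ?M"
      using P(2)[of n] Q(1)[of n] by (auto intro!: subset_interval_imp_cart)
    have I: "integrable lebesgue (?i (cbox a b))" "integrable lebesgue (?i (cbox (P n) (Q n)))" "integrable lebesgue (?i ?M)"
      using T_functional_indicator(1)[OF _ sub] T_functional_indicator(1)[OF _ subs(1)[of n]]
        T_functional_indicator(1)[OF _ subs(2)[of n]] by auto
    have T_box: "T n (indicator (cbox c d)) = (\<integral>x. cell_density f (\<lambda>_. n) x * ?i (cbox c d) x \<partial>lebesgue)"
      if "cbox c d \<subseteq> unit_cube" for c d
      by (rule T_functional_cell_density_eq) (use T_functional_indicator[OF _ that] in auto)
    have "T n (indicator (cbox a b)) - T n (indicator (cbox (P n) (Q n)))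
      = (\<integral>x. cell_density f (\<lambda>_. n) x * ?i (cbox a b) x - cell_density f (\<lambda>_. n) x * ?i (cbox (P n) (Q n)) x \<partial>lebesgue)"
      unfolding T_box[OF sub] T_box[OF subs(1)[of n]]
      by (subst Bochner_Integration.integral_diff) (simp_all add: integrable_cell_density_mult I)
    also have "\<bar>\<dots>\<bar> \<le> (\<integral>x. \<bar>cell_density f (\<lambda>_. n) x * ?i (cbox a b) x - cell_density f (\<lambda>_. n) x * ?i (cbox (P n) (Q n)) x\<bar> \<partial>lebesgue)"
      by (rule integral_abs_bound)
    also have "\<dots> \<le> (\<integral>x. (2 ^ CARD('n) * q) ^ n * C * ((?i ?M x - ?i (cbox a b) x) + (?i ?M x - ?i (cbox (P n) (Q n)) x)) \<partial>lebesgue)"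
    proof (rule integral_mono)
      fix x
      have "\<bar>?i (cbox a b) x - ?i (cbox (P n) (Q n)) x\<bar> \<le> (?i ?M x - ?i (cbox a b) x) + (?i ?M x - ?i (cbox (P n) (Q n)) x)"
        using K1 by (auto simp: indicator_def)
      then show "\<bar>cell_density f (\<lambda>_. n) x * ?i (cbox a b) x - cell_density f (\<lambda>_. n) x * ?i (cbox (P n) (Q n)) x\<bar>
        \<le> (2 ^ CARD('n) * q) ^ n * C * ((?i ?M x - ?i (cbox a b) x) + (?i ?M x - ?i (cbox (P n) (Q n)) x))"
        unfolding right_diff_distrib[symmetric] abs_mult
        using density_le C q by (intro mult_mono) auto
    qed (use I in \<open>auto intro!: integrable_cell_density_mult integrable_mult_right\<close>)
    also have "\<dots> = (2 ^ CARD('n) * q) ^ n * C * ((measure lebesgue ?M - measure lebesgue (cbox a b)) + (measure lebesgue ?M - measure lebesgue (cbox (P n) (Q n))))"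
      using I by simp
    also have "\<dots> \<le> (2 ^ CARD('n) * q) ^ n * C * (real CARD('n) * (1 / 2 ^ n) + real CARD('n) * (1 / 2 ^ n))"
    proof (intro mult_left_mono add_mono)
      have Pb: "P n $ i \<le> b $ i" for i using P(2)[of n i] ab[of i] by linarith
      have "\<bar>(b$i - P n$i) - (b$i - a$i)\<bar> \<le> 1 / 2 ^ n" for i
        using P(2)[of n i] P(3)[of i n] by linarith
      then have "\<bar>measure lebesgue ?M - measure lebesgue (cbox a b)\<bar> \<le> real CARD('n) * (1 / 2 ^ n)"
        using Pb ab by (intro measure_box_diff_le sub subs) (auto simp: less_imp_le)
      then show "measure lebesgue ?M - measure lebesgue (cbox a b) \<le> real CARD('n) * (1 / 2 ^ n)" by linarith
      have "\<bar>(b$i - P n$i) - (Q n$i - P n$i)\<bar> \<le> 1 / 2 ^ n" for i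
        using Q(1)[of n i] Q(2)[of i n] by linarith
      then have "\<bar>measure lebesgue ?M - measure lebesgue (cbox (P n) (Q n))\<bar> \<le> real CARD('n) * (1 / 2 ^ n)"
        using Pb PQ by (intro measure_box_diff_le subs) auto
      then show "measure lebesgue ?M - measure lebesgue (cbox (P n) (Q n)) \<le> real CARD('n) * (1 / 2 ^ n)" by linarith
    qed (use C q in auto)
    also have "\<dots> = 2 * real CARD('n) * C * ratio ^ n"
      by (simp add: ratio_def power_divide)
    finally show ?thesis .
  qed
  have lim_diff: "(\<lambda>n. T n (indicator (cbox a b)) - T n (indicator (cbox (P n) (Q n)))) \<longlonglongrightarrow> 0"
  proof (rule Lim_null_comparison)
    show "eventually (\<lambda>n. norm (T n (indicator (cbox a b)) - T n (indicator (cbox (P n) (Q n)))) \<le> 2 * real CARD('n) * C * ratio ^ n) sequentially"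
      using diff by simp
    have "(\<lambda>n. 2 * real CARD('n) * C * ratio ^ n) \<longlonglongrightarrow> 2 * real CARD('n) * C * 0"
      using ratio_bounds by (intro tendsto_mult_left LIMSEQ_power_zero) auto
    then show "(\<lambda>n. 2 * real CARD('n) * C * ratio ^ n) \<longlonglongrightarrow> 0" by simp
  qed
  have pow0: "(\<lambda>n. 1 / 2 ^ n :: real) \<longlonglongrightarrow> 0"
    using LIMSEQ_power_zero[of "1 / 2 :: real"] by (simp add: power_divide)
  have Pl: "(\<lambda>n. P n $ j) \<longlonglongrightarrow> a $ j" for j
  proof (rule LIM_zero_cancel, rule Lim_null_comparison[OF _ pow0])
    show "eventually (\<lambda>n. norm (P n $ j - a $ j) \<le> 1 / 2 ^ n) sequentially"
      using P(2)[of _ j] P(3)[of j] by (intro always_eventually allI) (smt (verit) real_norm_def)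
  qed
  have Ql: "(\<lambda>n. Q n $ j) \<longlonglongrightarrow> b $ j" for j
  proof (rule LIM_zero_cancel, rule Lim_null_comparison[OF _ pow0])
    show "eventually (\<lambda>n. norm (Q n $ j - b $ j) \<le> 1 / 2 ^ n) sequentially"
      using Q(1)[of _ j] Q(2)[of j] by (intro always_eventually allI) (smt (verit) real_norm_def)
  qed
  have "(\<lambda>n. box_increment f (P n) (Q n)) \<longlonglongrightarrow> box_increment f a b"
    unfolding box_increment_def
  proof (intro tendsto_sum tendsto_mult_left)
    fix S :: "'n set"
    have "(\<lambda>n. corner (P n) (Q n) S $ j) \<longlonglongrightarrow> corner a b S $ j" for j
      using Pl Ql by simp
    then have "(\<lambda>n. corner (P n) (Q n) S) \<longlonglongrightarrow> corner a b S" by (rule vec_tendstoI)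
    moreover have "corner a b S \<in> unit_cube"
    proof -
      have "0 \<le> corner a b S $ j \<and> corner a b S $ j \<le> 1" for j
        using ab01[of j] ab[of j] by auto
      then show ?thesis by (simp add: mem_box_cart)
    qed
    moreover have "corner (P n) (Q n) S \<in> unit_cube" for n
    proof -
      have "0 \<le> corner (P n) (Q n) S $ j \<and> corner (P n) (Q n) S $ j \<le> 1" for j
        using ab01[of j] P(1)[of n j] PQ[of n j] Q(1)[of n j] by auto
      then show ?thesis by (simp add: mem_box_cart)
    qed
    ultimately show "(\<lambda>n. f (corner (P n) (Q n) S)) \<longlonglongrightarrow> f (corner a b S)"
      by (intro continuous_on_tendsto_compose[OF cont]) auto
  qed
  from tendsto_add[OF lim_diff this] show ?thesis by (simp add: T_eq)
qed

end

section \<open>Figures and the strong charge\<close>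

lemma rectangle_imp_figure: "rectangle K \<Longrightarrow> figure K"
  unfolding figure_def by (intro exI[of _ "{K}"]) auto

lemma figure_Union:
  assumes "finite p" "\<And>K. K \<in> p \<Longrightarrow> rectangle K"
  shows "figure (\<Union>p)"
  unfolding figure_def using assms by blast

lemma figure_sets:
  assumes "figure F" shows "F \<in> sets lebesgue" "F \<subseteq> unit_cube"
proof -
  obtain \<K> where \<K>: "finite \<K>" "\<And>K. K \<in> \<K> \<Longrightarrow> rectangle K" "F = \<Union>\<K>"
    using assms by (auto simp: figure_def)
  have "K \<in> sets lebesgue \<and> K \<subseteq> unit_cube" if "K \<in> \<K>" for K
    using \<K>(2)[OF that] by (auto simp: rectangle_def)
  then show "F \<in> sets lebesgue" "F \<subseteq> unit_cube"
    unfolding \<K>(3) using \<K>(1) by (auto intro!: sets.finite_Union)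
qed

text \<open>A division of the figure into boxes may contain degenerate ones. They can be dropped: what the others
  miss of a rectangle is, within its interior, an open negligible set and hence empty.\<close>

lemma figure_division:
  assumes "figure F"
  obtains p where "finite p" "\<And>K. K \<in> p \<Longrightarrow> rectangle K" 
    "pairwise (\<lambda>A B. negligible (A \<inter> B)) p" "F = \<Union>p"
proof -
  obtain \<K> where \<K>: "finite \<K>" "\<And>K. K \<in> \<K> \<Longrightarrow> rectangle K" "F = \<Union>\<K>"
    using assms by (auto simp: figure_def)
  have "\<exists>a b. K = cbox a b" if "K \<in> \<K>" for K
    using \<K>(2)[OF that] by (auto simp: rectangle_def)
  then obtain p where p: "p division_of F"
    using elementary_unions_intervals[OF \<K>(1)] \<K>(3) by metis
  define p' where "p' = {K \<in> p. interior K \<noteq> {}}"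
  note pD = division_ofD[OF p]
  have fin: "finite p'" "finite (p - p')" using pD(1) by (auto simp: p'_def)
  have rect: "rectangle K" if K: "K \<in> p'" for K
  proof -
    have Kp: "K \<in> p" "interior K \<noteq> {}" using K by (auto simp: p'_def)
    obtain a b where ab: "K = cbox a b" using pD(4)[OF Kp(1)] by blast
    then have "\<forall>i. a$i < b$i" using Kp(2) by (simp add: interval_ne_empty_cart)
    moreover have "K \<subseteq> unit_cube" using pD(2)[OF Kp(1)] figure_sets[OF assms] by blast
    ultimately show ?thesis using ab unfolding rectangle_def by blast
  qed
  have pw: "pairwise (\<lambda>A B. negligible (A \<inter> B)) p'"
  proof (rule pairwiseI)
    fix A B assume AB: "A \<in> p'" "B \<in> p'" "A \<noteq> B"
    then have AB': "A \<in> p" "B \<in> p" by (auto simp: p'_def)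
    obtain a b where A: "A = cbox a b" using pD(4)[OF AB'(1)] by blast
    obtain c d where B: "B = cbox c d" using pD(4)[OF AB'(2)] by blast
    have "interior A \<inter> interior B = {}" using pD(5)[OF AB' AB(3)] .
    then have "A \<inter> B \<subseteq> frontier A \<union> frontier B"
      by (auto simp: frontier_def A B)
    moreover have "negligible (frontier A \<union> frontier B)"
      unfolding A B by (intro negligible_Un negligible_convex_frontier convex_box)
    ultimately show "negligible (A \<inter> B)" by (rule negligible_subset[rotated])
  qed
  have Z: "negligible (\<Union>(p - p'))"
  proof (rule negligible_Union[OF fin(2)])
    fix K assume "K \<in> p - p'"
    then have K: "K \<in> p" "interior K = {}" by (auto simp: p'_def)
    obtain a b where "K = cbox a b" using pD(4)[OF K(1)] by blast
    then show "negligible K" using K(2) by (simp add: negligible_convex_interior)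
  qed
  have closed: "closed (\<Union>p')"
    by (rule closed_Union[OF fin(1)]) (use rect in \<open>auto simp: rectangle_def\<close>)
  have "F = \<Union>p'"
  proof
    show "\<Union>p' \<subseteq> F" using pD(6) by (auto simp: p'_def)
    show "F \<subseteq> \<Union>p'"
      unfolding \<K>(3)
    proof (rule Union_least)
      fix L assume L: "L \<in> \<K>"
      then obtain a b where ab: "L = cbox a b" "\<forall>i. a$i < b$i"
        using \<K>(2)[OF L] unfolding rectangle_def by blast
      have "interior L - \<Union>p' \<subseteq> \<Union>(p - p')"
        using L \<K>(3) pD(6) interior_subset[of L] by blast
      then have "negligible (interior L - \<Union>p')" by (rule negligible_subset[OF Z])
      moreover have "open (interior L - \<Union>p')" using closed by auto
      ultimately have "interior L \<subseteq> \<Union>p'" using open_not_negligible by blast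
      then have "closure (interior L) \<subseteq> \<Union>p'" using closed by (simp add: closure_minimal)
      moreover have "closure (interior L) = L"
        unfolding ab(1) by (subst convex_closure_interior) (use ab in \<open>auto simp: interval_ne_empty_cart\<close>)
      ultimately show "L \<subseteq> \<Union>p'" by simp
    qed
  qed
  with fin(1) rect pw show ?thesis by (rule that)
qed

lemma negligible_Int_Union_pairwise:
  assumes "finite p" "pairwise (\<lambda>A B. negligible (A \<inter> B)) (insert K p)" "K \<notin> p"
  shows "negligible (K \<inter> \<Union>p)"
  unfolding Int_Union
proof (rule negligible_Union)
  fix L assume "L \<in> (\<inter>) K ` p"
  then obtain B where "B \<in> p" "L = K \<inter> B" by blast
  then show "negligible L" using assms(2,3) by (auto simp: pairwise_insert)
qed (use assms in auto)

lemma additive_extension_Union: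
  assumes "additive_extension f \<nu>" "finite p" "\<And>K. K \<in> p \<Longrightarrow> rectangle K"
    "pairwise (\<lambda>A B. negligible (A \<inter> B)) p"
  shows "\<nu> (\<Union>p) = (\<Sum>K\<in>p. \<nu> K)"
  using assms(2-4)
proof (induction p rule: finite_induct)
  case empty
  have "figure {}" using figure_Union[of "{}"] by simp
  then have "\<nu> ({} \<union> {}) = \<nu> {} + \<nu> {}"
    using assms(1) unfolding additive_extension_def by (metis Int_empty_left negligible_empty)
  then show ?case by simp
next
  case (insert K p)
  have "negligible (K \<inter> \<Union>p)"
    by (rule negligible_Int_Union_pairwise) (use insert in auto)
  moreover have "figure K" by (rule rectangle_imp_figure) (use insert in auto)
  moreover have "figure (\<Union>p)" by (rule figure_Union) (use insert in auto)
  ultimately have "\<nu> (K \<union> \<Union>p) = \<nu> K + \<nu> (\<Union>p)"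
    using assms(1) unfolding additive_extension_def by blast
  then show ?case using insert by (simp add: pairwise_insert)
qed

lemma additive_extension_unique:
  assumes "additive_extension f \<nu>" "additive_extension f \<nu>'" "figure F"
  shows "\<nu> F = \<nu>' F"
proof -
  obtain p where p: "finite p" "\<And>K. K \<in> p \<Longrightarrow> rectangle K" 
    "pairwise (\<lambda>A B. negligible (A \<inter> B)) p" "F = \<Union>p"
    using figure_division[OF assms(3)] by blast
  have "\<nu> K = \<nu>' K" if "K \<in> p" for K
    using p(2)[OF that] assms(1,2) by (auto simp: rectangle_def additive_extension_def)
  then show ?thesis
    using additive_extension_Union[OF assms(1) p(1-3)] additive_extension_Union[OF assms(2) p(1-3)] p(4) by simp
qed

context holder_increments
begin

lemma T_indicator_Un:
  assumes "F \<in> sets lebesgue" "F \<subseteq> unit_cube" "G \<in> sets lebesgue" "G \<subseteq> unit_cube" "negligible (F \<inter> G)"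
  shows "T n (indicator (F \<union> G)) = T n (indicator F) + T n (indicator G)"
proof -
  note F = T_functional_indicator[OF assms(1,2)]
  note G = T_functional_indicator[OF assms(3,4)]
  have FG: "F \<union> G \<in> sets lebesgue" "F \<union> G \<subseteq> unit_cube" using assms by auto
  note U = T_functional_indicator[OF FG]
  have "T n (indicator (F \<union> G)) = (\<integral>x. cell_density f (\<lambda>_. n) x * indicator (F \<union> G) x \<partial>lebesgue)"
    by (rule T_functional_cell_density_eq[OF U(2,1)])
  also have "\<dots> = (\<integral>x. cell_density f (\<lambda>_. n) x * indicator F x + cell_density f (\<lambda>_. n) x * indicator G x \<partial>lebesgue)"
  proof (rule integral_cong_AE)
    have "F \<inter> G \<in> null_sets lebesgue" using assms(5) by (simp add: negligible_iff_null_sets)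
    then have "AE x in lebesgue. x \<notin> F \<inter> G" by (rule AE_not_in)
    then show "AE x in lebesgue. cell_density f (\<lambda>_. n) x * indicator (F \<union> G) x = cell_density f (\<lambda>_. n) x * indicator F x + cell_density f (\<lambda>_. n) x * indicator G x"
      by eventually_elim (auto simp: indicator_def)
  qed (use integrable_cell_density_mult[OF U(1)] integrable_cell_density_mult[OF F(1)] integrable_cell_density_mult[OF G(1)] in auto)
  also have "\<dots> = T n (indicator F) + T n (indicator G)"
    by (subst Bochner_Integration.integral_add)
       (simp_all add: T_functional_cell_density_eq[OF F(2,1)] T_functional_cell_density_eq[OF G(2,1)] integrable_cell_density_mult F(1) G(1))
  finally show ?thesis .
qed

lemma convergent_T_figure:
  assumes cont: "continuous_on unit_cube f" and F: "figure F"
  shows "convergent (\<lambda>n. T n (indicator F))"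
proof -
  obtain p where p: "finite p" "\<And>K. K \<in> p \<Longrightarrow> rectangle K" 
    "pairwise (\<lambda>A B. negligible (A \<inter> B)) p" "F = \<Union>p"
    using figure_division[OF F] by blast
  have "convergent (\<lambda>n. T n (indicator (\<Union>p)))"
    using p(1-3)
  proof (induction p rule: finite_induct)
    case empty
    have "(\<lambda>n. T n (indicator (\<Union>{}))) = (\<lambda>n. 0)"
      by (simp add: T_functional_def set_lebesgue_integral_def)
    then show ?case by (simp only: convergent_const)
  next
    case (insert K p)
    have "negligible (K \<inter> \<Union>p)"
      by (rule negligible_Int_Union_pairwise) (use insert in auto)
    moreover have K: "rectangle K" using insert by simp
    moreover have "figure K" using K by (rule rectangle_imp_figure)
    moreover have "figure (\<Union>p)" by (rule figure_Union) (use insert in auto)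
    ultimately have eq: "T n (indicator (\<Union>(insert K p))) = T n (indicator K) + T n (indicator (\<Union>p))" for n
      unfolding Union_insert by (intro T_indicator_Un figure_sets)
    have "convergent (\<lambda>n. T n (indicator K))"
      using K T_indicator_tendsto_increment[OF cont] by (auto simp: rectangle_def convergent_def)
    moreover have "convergent (\<lambda>n. T n (indicator (\<Union>p)))"
      using insert by (auto simp: pairwise_insert)
    ultimately show ?case unfolding eq by (rule convergent_add)
  qed
  then show ?thesis by (simp add: p(4))
qed

text \<open>Additivity is inherited from the functionals \<open>T n\<close>: they converge on figures because they converge on
  the boxes that make up a figure.\<close>

lemma limit_functional_additive_extension:
  assumes cont: "continuous_on unit_cube f"
  shows "additive_extension f (\<lambda>F. limit_functional (indicator F))"
  unfolding additive_extension_def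
proof (intro conjI allI impI; elim conjE)
  fix a b :: "real^'n" assume ab: "\<forall>i. a$i < b$i" "cbox a b \<subseteq> unit_cube"
  then have "(\<lambda>n. T n (indicator (cbox a b))) \<longlonglongrightarrow> box_increment f a b"
    by (intro T_indicator_tendsto_increment cont) auto
  then show "limit_functional (indicator (cbox a b)) = rectangle_increment f a b"
    using ab by (simp add: limit_functional_def limI rectangle_increment_eq_box_increment)
next
  fix F G :: "(real^'n) set" assume FG: "figure F" "figure G" "negligible (F \<inter> G)"
  have "T n (indicator (F \<union> G)) = T n (indicator F) + T n (indicator G)" for n
    by (intro T_indicator_Un figure_sets FG)
  moreover have "(\<lambda>n. T n (indicator F) + T n (indicator G)) \<longlonglongrightarrow> limit_functional (indicator F) + limit_functional (indicator G)"
    using convergent_T_figure[OF cont] FG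
    by (intro tendsto_add) (auto simp: limit_functional_def convergent_LIMSEQ_iff)
  ultimately show "limit_functional (indicator (F \<union> G)) = limit_functional (indicator F) + limit_functional (indicator G)"
    by (simp add: limit_functional_def[of "indicator (F \<union> G)"] limI)
qed

end

lemma measure_dyadic_cube:
  "measure lebesgue (cbox (grid_point (\<lambda>_. n) k) (grid_point (\<lambda>_. n) (\<lambda>i. k i + 1)) :: (real^'n) set) = 2 powr (- (real n * real CARD('n)))"
proof -
  have "measure lebesgue (cbox (grid_point (\<lambda>_. n) k) (grid_point (\<lambda>_. n) (\<lambda>i. k i + 1)) :: (real^'n) set)
     = measure lebesgue (cell (\<lambda>_. n) k :: (real^'n) set)"
    unfolding cell_def by (simp add: measure_lborel_box_eq measure_lborel_cbox_eq)
  also have "\<dots> = 2 powr (- (real n * real CARD('n)))"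
    unfolding measure_cell powr_minus
    by (simp add: powr_realpow[symmetric] inverse_eq_divide mult.commute)
  finally show ?thesis .
qed

text \<open>The bound with exponent \<open>\<gamma>\<close> produces the strong charge; its values on dyadic cubes, of volume at
  most 1, then satisfy the weaker bound with \<open>\<gamma>'\<close>.\<close>

theorem holder_strongly_chargeableI:
  fixes f :: "real^'n \<Rightarrow> real"
  assumes f: "f \<in> C0_cube" and C: "0 \<le> C" and \<gamma>: "\<gamma> > (real CARD('n) - 1) / real CARD('n)"
    and bound: "\<And>n k. k \<in> grid (\<lambda>_. n) \<Longrightarrow> \<bar>cell_increment f (\<lambda>_. n) k\<bar> \<le> C * 2 powr (- (real n * real CARD('n) * \<gamma>))"
    and \<gamma>': "\<gamma>' \<le> \<gamma>"
  shows "holder_strongly_chargeable \<gamma>' f"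
proof -
  define q :: real where "q = 2 powr (- (real CARD('n) * \<gamma>))"
  have q_pow: "q ^ n = 2 powr (- (real n * real CARD('n) * \<gamma>))" for n
    by (simp add: q_def powr_realpow[symmetric] powr_powr mult_ac)
  have cont: "continuous_on unit_cube f" using f by (simp add: C0_cube_def)
  interpret holder_increments f C q
  proof
    have "real CARD('n) - 1 < real CARD('n) * \<gamma>"
      using \<gamma> by (simp add: field_simps)
    then have "2 powr (real CARD('n) + - (real CARD('n) * \<gamma>)) < (2::real) powr 1"
      by (intro powr_less_mono) auto
    then show "2 ^ CARD('n) * q < 2" unfolding powr_add q_def by (simp add: powr_realpow)
    show "\<bar>cell_increment f (\<lambda>_. n) k\<bar> \<le> C * q ^ n" if "k \<in> grid (\<lambda>_. n)" for n k
      using bound[OF that] by (simp add: q_pow)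
  qed (use C in \<open>auto simp: q_def\<close>)
  define \<mu> where "\<mu> = (\<lambda>F. limit_functional (indicator F))"
  have ext: "additive_extension f \<mu>" unfolding \<mu>_def by (rule limit_functional_additive_extension[OF cont])
  have "strong_charge \<mu>"
    unfolding strong_charge_def \<mu>_def using limit_functional_SCH by blast
  moreover have "\<mu> F = figure_increment f F" if "figure F" for F
  proof -
    have "additive_extension f (figure_increment f)"
      unfolding figure_increment_def by (rule someI[of "additive_extension f", OF ext])
    then show ?thesis using ext that by (intro additive_extension_unique)
  qed
  moreover have "holder_charge \<gamma>' \<mu>"
    unfolding holder_charge_def
  proof (intro exI[of _ C] conjI C allI impI)
    fix K :: "(real^'n) set" assume "dyadic_cube K"
    then obtain n k where k: "\<forall>i. k i < 2 ^ n" 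
      and "K = cbox (\<chi> i. real (k i) / 2 ^ n) (\<chi> i. (real (k i) + 1) / 2 ^ n)"
      by (auto simp: dyadic_cube_def)
    then have K: "K = cbox (grid_point (\<lambda>_. n) k) (grid_point (\<lambda>_. n) (\<lambda>i. k i + 1))"
      by (simp add: grid_point_def add.commute)
    have kg: "k \<in> grid (\<lambda>_. n)" using k by (simp add: mem_grid)
    have lt: "grid_point (\<lambda>_. n) k $ i < grid_point (\<lambda>_. n) (\<lambda>i. k i + 1) $ i" for i
      by (simp add: divide_strict_right_mono)
    have "K \<subseteq> unit_cube"
      unfolding K
    proof (rule subset_interval_imp_cart, intro allI conjI)
      fix i
      have "k i + 1 \<le> 2 ^ n" using k by (simp add: Suc_le_eq)
      then show "grid_point (\<lambda>_. n) (\<lambda>i. k i + 1) $ i \<le> (1 :: real^'n) $ i"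
        using of_nat_mono[of "k i + 1" "2 ^ n", where 'a=real] by simp
    qed simp
    then have "\<mu> K = cell_increment f (\<lambda>_. n) k"
      using ext lt by (simp add: additive_extension_def K cell_increment_def rectangle_increment_eq_box_increment)
    then have "\<bar>\<mu> K\<bar> \<le> C * 2 powr (- (real n * real CARD('n) * \<gamma>))"
      using bound[OF kg] by simp
    also have "\<dots> \<le> C * 2 powr (- (real n * real CARD('n) * \<gamma>'))"
      using C \<gamma>' by (intro mult_left_mono powr_mono) (auto intro!: mult_left_mono)
    also have "\<dots> = C * measure lebesgue K powr \<gamma>'"
      unfolding K measure_dyadic_cube by (simp add: powr_powr)
    finally show "\<bar>\<mu> K\<bar> \<le> C * measure lebesgue K powr \<gamma>'" .
  qed
  ultimately show ?thesis using f unfolding holder_strongly_chargeable_def by blast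
qed

section \<open>Dyadic increments of the fractional Brownian sheet\<close>

context prob_space
begin

lemma gaussian_rv_square_integrable:
  assumes "gaussian_rv M X"
  shows "integrable M (\<lambda>\<omega>. (X \<omega>)\<^sup>2)" "integrable M X"
proof -
  have X[measurable]: "X \<in> borel_measurable M" using assms by (simp add: gaussian_rv_def)
  show sq: "integrable M (\<lambda>\<omega>. (X \<omega>)\<^sup>2)"
  proof (cases "\<exists>m. AE \<omega> in M. X \<omega> = m")
    case True
    then obtain m where "AE \<omega> in M. X \<omega> = m" by blast
    then have "AE \<omega> in M. m\<^sup>2 = (X \<omega>)\<^sup>2" by eventually_elim simp
    then show ?thesis by (rule integrable_cong_AE_imp[rotated 2]) auto
  next
    case False
    then obtain m s where s: "s > 0" "distributed M lborel X (normal_density m s)"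
      using assms by (auto simp: gaussian_rv_def)
    have "integrable lborel (\<lambda>x. normal_density m s x * (x - m)^2 + (2 * m) * (normal_density m s x * (x - m)^1) + m\<^sup>2 * (normal_density m s x * (x - m)^0))"
      by (intro Bochner_Integration.integrable_add integrable_mult_right integrable_normal_moment s(1))
    then have "integrable lborel (\<lambda>x. normal_density m s x * x\<^sup>2)"
      by (rule Bochner_Integration.integrable_cong[THEN iffD1, rotated -1]) (auto simp: algebra_simps power2_eq_square)
    then show ?thesis by (subst (asm) distributed_integrable[OF s(2)]) auto
  qed
  show "integrable M X" by (rule square_integrable_imp_integrable[OF X sq])
qed

text \<open>Constants count as Gaussian; a centred constant is 0, which agrees with the formula for \<open>v = 0\<close>.\<close>

lemma gaussian_rv_even_moment:
  assumes X: "gaussian_rv M X" and mean: "expectation X = 0" and var: "expectation (\<lambda>\<omega>. (X \<omega>)\<^sup>2) = v"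
  shows "integrable M (\<lambda>\<omega>. X \<omega> ^ (2 * k))"
    and "expectation (\<lambda>\<omega>. X \<omega> ^ (2 * k)) = fact (2 * k) / (2 ^ k * fact k) * v ^ k"
proof -
  have Xm[measurable]: "X \<in> borel_measurable M" using X by (simp add: gaussian_rv_def)
  have "integrable M (\<lambda>\<omega>. X \<omega> ^ (2 * k)) \<and> expectation (\<lambda>\<omega>. X \<omega> ^ (2 * k)) = fact (2 * k) / (2 ^ k * fact k) * v ^ k"
  proof (cases "\<exists>m. AE \<omega> in M. X \<omega> = m")
    case True
    then obtain m where m: "AE \<omega> in M. X \<omega> = m" by blast
    have "expectation X = expectation (\<lambda>_. m)" by (rule integral_cong_AE) (use m in auto)
    then have "m = 0" using mean by (simp add: prob_space)
    with m have m0: "AE \<omega> in M. X \<omega> = 0" by simp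
    then have p: "AE \<omega> in M. X \<omega> ^ j = 0 ^ j" for j by eventually_elim simp
    have e: "expectation (\<lambda>\<omega>. X \<omega> ^ j) = 0 ^ j" for j
    proof -
      have "expectation (\<lambda>\<omega>. X \<omega> ^ j) = expectation (\<lambda>\<omega>. 0 ^ j)" by (rule integral_cong_AE) (use p in auto)
      then show ?thesis by (simp add: prob_space)
    qed
    have "AE \<omega> in M. 0 ^ (2 * k) = X \<omega> ^ (2 * k)" using m0 by eventually_elim simp
    then have "integrable M (\<lambda>\<omega>. X \<omega> ^ (2 * k))"
      by (rule integrable_cong_AE_imp[rotated 2]) auto
    moreover have "v = 0" using var e[of 2] by simp
    ultimately show ?thesis by (cases "k = 0") (simp_all add: e power_0_left prob_space)
  next
    case False
    then obtain m s where s: "s > 0" "distributed M lborel X (normal_density m s)"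
      using X by (auto simp: gaussian_rv_def)
    have "m = 0" using normal_distributed_expectation[OF s] mean by simp
    have v: "v = s\<^sup>2" using normal_distributed_variance[OF s] mean var by simp
    have h: "has_bochner_integral lborel (\<lambda>x. normal_density m s x * x ^ (2 * k)) (fact (2 * k) / ((2 / s\<^sup>2)^k * fact k))"
      using normal_moment_even[OF s(1), of m k] \<open>m = 0\<close> by simp
    have "integrable M (\<lambda>\<omega>. X \<omega> ^ (2 * k))"
      using h by (subst distributed_integrable[OF s(2), symmetric]) (auto simp: has_bochner_integral_iff)
    moreover have "expectation (\<lambda>\<omega>. X \<omega> ^ (2 * k)) = fact (2 * k) / ((2 / s\<^sup>2)^k * fact k)"
      using h by (subst distributed_integral[OF s(2), symmetric]) (auto simp: has_bochner_integral_iff)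
    ultimately show ?thesis using s(1) by (simp add: v power_divide)
  qed
  then show "integrable M (\<lambda>\<omega>. X \<omega> ^ (2 * k))"
    and "expectation (\<lambda>\<omega>. X \<omega> ^ (2 * k)) = fact (2 * k) / (2 ^ k * fact k) * v ^ k" by auto
qed

text \<open>Markov's inequality for the moment of order \<open>2 k\<close>.\<close>

lemma gaussian_rv_tail:
  assumes X: "gaussian_rv M X" and mean: "expectation X = 0" and var: "expectation (\<lambda>\<omega>. (X \<omega>)\<^sup>2) = v"
    and l: "0 < l"
  shows "prob {\<omega>\<in>space M. \<bar>X \<omega>\<bar> > l} \<le> fact (2 * k) / (2 ^ k * fact k) * v ^ k / l ^ (2 * k)"
proof -
  have Xm[measurable]: "X \<in> borel_measurable M" using X by (simp add: gaussian_rv_def)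
  have "prob {\<omega>\<in>space M. \<bar>X \<omega>\<bar> > l} \<le> prob {\<omega>\<in>space M. X \<omega> ^ (2 * k) \<ge> l ^ (2 * k)}"
  proof (rule finite_measure_mono)
    show "{\<omega>\<in>space M. \<bar>X \<omega>\<bar> > l} \<subseteq> {\<omega>\<in>space M. X \<omega> ^ (2 * k) \<ge> l ^ (2 * k)}"
    proof safe
      fix \<omega> assume "\<bar>X \<omega>\<bar> > l"
      then have "l ^ (2 * k) \<le> \<bar>X \<omega>\<bar> ^ (2 * k)" using l by (intro power_mono) auto
      then show "l ^ (2 * k) \<le> X \<omega> ^ (2 * k)" by (simp add: power_even_abs)
    qed
  qed measurable
  also have "\<dots> \<le> expectation (\<lambda>\<omega>. X \<omega> ^ (2 * k)) / l ^ (2 * k)"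
    by (rule integral_Markov_inequality_measure[where A="{}"])
       (use gaussian_rv_even_moment(1)[OF X mean var] l in \<open>auto simp: power_mult\<close>)
  finally show ?thesis unfolding gaussian_rv_even_moment(2)[OF X mean var] .
qed

end

locale fractional_sheet = prob_space M for M :: "'w measure" +
  fixes H :: "real^'n" and W :: "real^'n \<Rightarrow> 'w \<Rightarrow> real"
  assumes W: "fractional_brownian_sheet M H W"
begin

lemma W_combination:
  assumes "finite S" "S \<subseteq> unit_cube"
  shows "gaussian_rv M (\<lambda>\<omega>. \<Sum>t\<in>S. c t * W t \<omega>)"
  using W assms unfolding fractional_brownian_sheet_def gaussian_process_def by simp

lemma W_gaussian:
  assumes "t \<in> unit_cube" shows "gaussian_rv M (W t)"
proof -
  have "gaussian_rv M (\<lambda>\<omega>. \<Sum>s\<in>{t}. (\<lambda>_. 1) s * W s \<omega>)"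
    using assms by (intro W_combination) auto
  then show ?thesis by simp
qed

lemma W_mean: "t \<in> unit_cube \<Longrightarrow> expectation (W t) = 0"
  and W_cov: "s \<in> unit_cube \<Longrightarrow> t \<in> unit_cube \<Longrightarrow> expectation (\<lambda>\<omega>. W s \<omega> * W t \<omega>) = fbs_covariance H s t"
  using W by (auto simp: fractional_brownian_sheet_def)

lemma W_prod_integrable:
  assumes "s \<in> unit_cube" "t \<in> unit_cube"
  shows "integrable M (\<lambda>\<omega>. W s \<omega> * W t \<omega>)"
proof (rule Bochner_Integration.integrable_bound)
  note st = W_gaussian[OF assms(1)] W_gaussian[OF assms(2)]
  show "integrable M (\<lambda>\<omega>. (W s \<omega>)\<^sup>2 + (W t \<omega>)\<^sup>2)"
    by (intro Bochner_Integration.integrable_add gaussian_rv_square_integrable(1) st)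
  have [measurable]: "W s \<in> borel_measurable M" "W t \<in> borel_measurable M"
    using st by (auto simp: gaussian_rv_def)
  show "(\<lambda>\<omega>. W s \<omega> * W t \<omega>) \<in> borel_measurable M" by measurable
  have "\<bar>x * y\<bar> \<le> \<bar>x\<^sup>2 + y\<^sup>2\<bar>" for x y :: real
  proof -
    have "2 * (\<bar>x\<bar> * \<bar>y\<bar>) \<le> x\<^sup>2 + y\<^sup>2"
      using sum_squares_bound[of "\<bar>x\<bar>" "\<bar>y\<bar>"] by (simp add: mult.assoc)
    moreover have "0 \<le> \<bar>x\<bar> * \<bar>y\<bar>" by simp
    ultimately show ?thesis unfolding abs_mult by linarith
  qed
  then show "AE \<omega> in M. norm (W s \<omega> * W t \<omega>) \<le> norm ((W s \<omega>)\<^sup>2 + (W t \<omega>)\<^sup>2)" by simp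
qed

text \<open>In each coordinate the mixed second difference of \<open>(x\<^sup>2\<^sup>H + y\<^sup>2\<^sup>H - |x - y|\<^sup>2\<^sup>H) / 2\<close> cancels everything
  but \<open>(b - a)\<^sup>2\<^sup>H\<close>.\<close>

lemma fbs_covariance_increment:
  assumes "\<And>i. a$i < b$i"
  shows "box_increment (\<lambda>s. box_increment (\<lambda>t. fbs_covariance H s t) a b) a b = (\<Prod>i\<in>UNIV. (b$i - a$i) powr (2 * H$i))"
proof -
  define R where "R i x y = (x powr (2 * H$i) + y powr (2 * H$i) - \<bar>x - y\<bar> powr (2 * H$i)) / 2" for i x y
  have "box_increment (\<lambda>s. box_increment (\<lambda>t. fbs_covariance H s t) a b) a b
     = box_increment (\<lambda>s. \<Prod>i\<in>UNIV. R i (s$i) (b$i) - R i (s$i) (a$i)) a b"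
    unfolding fbs_covariance_def R_def[symmetric] by (subst box_increment_prod) (rule refl)
  also have "\<dots> = (\<Prod>i\<in>UNIV. (R i (b$i) (b$i) - R i (b$i) (a$i)) - (R i (a$i) (b$i) - R i (a$i) (a$i)))"
    by (rule box_increment_prod)
  also have "\<dots> = (\<Prod>i\<in>UNIV. (b$i - a$i) powr (2 * H$i))"
  proof (rule prod.cong[OF refl])
    fix i
    have "\<bar>a$i - b$i\<bar> = b$i - a$i" "\<bar>b$i - a$i\<bar> = b$i - a$i" using assms[of i] by auto
    then show "(R i (b$i) (b$i) - R i (b$i) (a$i)) - (R i (a$i) (b$i) - R i (a$i) (a$i)) = (b$i - a$i) powr (2 * H$i)"
      by (simp add: R_def field_simps)
  qed
  finally show ?thesis .
qed

lemma corner_unit_cube: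
  assumes "\<And>i. 0 \<le> a$i" "\<And>i. a$i < b$i" "\<And>i. b$i \<le> 1"
  shows "corner a b S \<in> unit_cube"
proof -
  have "0 \<le> corner a b S $ i \<and> corner a b S $ i \<le> 1" for i
    using assms[of i] by auto
  then show ?thesis by (simp add: mem_box_cart)
qed

lemma box_increment_sheet:
  assumes ab: "\<And>i. 0 \<le> a$i" "\<And>i. a$i < b$i" "\<And>i. b$i \<le> 1"
  shows "gaussian_rv M (\<lambda>\<omega>. box_increment (\<lambda>t. W t \<omega>) a b)"
    and "expectation (\<lambda>\<omega>. box_increment (\<lambda>t. W t \<omega>) a b) = 0"
    and "expectation (\<lambda>\<omega>. (box_increment (\<lambda>t. W t \<omega>) a b)\<^sup>2) = (\<Prod>i\<in>UNIV. (b$i - a$i) powr (2 * H$i))"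
proof -
  note cu = corner_unit_cube[OF ab]
  have "box_increment (\<lambda>t. W t \<omega>) a b = (\<Sum>c\<in>range (corner a b). (-1) ^ card {i. c$i = a$i} * W c \<omega>)" for \<omega>
    unfolding rectangle_increment_eq_box_increment[OF ab(2), symmetric] rectangle_increment_def vertices_eq_corners ..
  moreover have "gaussian_rv M (\<lambda>\<omega>. \<Sum>c\<in>range (corner a b). (-1) ^ card {i. c$i = a$i} * W c \<omega>)"
    using cu by (intro W_combination) auto
  ultimately show "gaussian_rv M (\<lambda>\<omega>. box_increment (\<lambda>t. W t \<omega>) a b)" by simp
  have i: "integrable M (W (corner a b S))" for S by (intro gaussian_rv_square_integrable W_gaussian cu)
  show "expectation (\<lambda>\<omega>. box_increment (\<lambda>t. W t \<omega>) a b) = 0"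
    unfolding box_increment_def by (subst Bochner_Integration.integral_sum) (auto simp: i W_mean cu)
  have "expectation (\<lambda>\<omega>. (box_increment (\<lambda>t. W t \<omega>) a b)\<^sup>2)
     = expectation (\<lambda>\<omega>. \<Sum>S\<in>UNIV. \<Sum>S'\<in>UNIV. ((-1) ^ card S * (-1) ^ card S') * (W (corner a b S) \<omega> * W (corner a b S') \<omega>))"
    unfolding box_increment_def power2_eq_square sum_product by (simp add: mult_ac)
  also have "\<dots> = (\<Sum>S\<in>UNIV. \<Sum>S'\<in>UNIV. ((-1) ^ card S * (-1) ^ card S') * fbs_covariance H (corner a b S) (corner a b S'))"
    by (subst Bochner_Integration.integral_sum; (subst Bochner_Integration.integral_sum)?)
       (auto simp: W_cov cu intro!: Bochner_Integration.integrable_sum integrable_mult_right W_prod_integrable)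
  also have "\<dots> = box_increment (\<lambda>s. box_increment (\<lambda>t. fbs_covariance H s t) a b) a b"
    by (simp add: box_increment_def sum_distrib_left mult_ac)
  also have "\<dots> = (\<Prod>i\<in>UNIV. (b$i - a$i) powr (2 * H$i))"
    by (rule fbs_covariance_increment[OF ab(2)])
  finally show "expectation (\<lambda>\<omega>. (box_increment (\<lambda>t. W t \<omega>) a b)\<^sup>2) = (\<Prod>i\<in>UNIV. (b$i - a$i) powr (2 * H$i))" .
qed

lemma card_grid: "card (grid (\<lambda>_::'n. n)) = 2 ^ (n * CARD('n))"
  by (simp add: grid_def card_PiE power_mult)

lemma cell_increment_sheet:
  assumes "k \<in> grid (\<lambda>_. n)"
  shows "gaussian_rv M (\<lambda>\<omega>. cell_increment (\<lambda>t. W t \<omega>) (\<lambda>_. n) k)"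
    and "expectation (\<lambda>\<omega>. cell_increment (\<lambda>t. W t \<omega>) (\<lambda>_. n) k) = 0"
    and "expectation (\<lambda>\<omega>. (cell_increment (\<lambda>t. W t \<omega>) (\<lambda>_. n) k)\<^sup>2) = 2 powr (- (2 * real n * (\<Sum>i\<in>UNIV. H$i)))"
proof -
  let ?a = "grid_point (\<lambda>_. n) k" and ?b = "grid_point (\<lambda>_. n) (\<lambda>i. k i + 1)"
  have ab: "0 \<le> ?a$i" "?a$i < ?b$i" "?b$i \<le> 1" for i
  proof -
    show "0 \<le> ?a$i" by simp
    show "?a$i < ?b$i" by (simp add: divide_strict_right_mono)
    have "k i + 1 \<le> 2 ^ n" using assms by (simp add: mem_grid Suc_le_eq)
    then show "?b$i \<le> 1" using of_nat_mono[of "k i + 1" "2 ^ n", where 'a=real] by simp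
  qed
  show "gaussian_rv M (\<lambda>\<omega>. cell_increment (\<lambda>t. W t \<omega>) (\<lambda>_. n) k)"
    "expectation (\<lambda>\<omega>. cell_increment (\<lambda>t. W t \<omega>) (\<lambda>_. n) k) = 0"
    unfolding cell_increment_def by (rule box_increment_sheet; fact ab)+
  have "expectation (\<lambda>\<omega>. (cell_increment (\<lambda>t. W t \<omega>) (\<lambda>_. n) k)\<^sup>2) = (\<Prod>i\<in>UNIV. (?b$i - ?a$i) powr (2 * H$i))"
    unfolding cell_increment_def by (rule box_increment_sheet; fact ab)
  also have "\<dots> = (\<Prod>i\<in>UNIV. 2 powr (- (2 * real n * H$i)))"
  proof (rule prod.cong[OF refl])
    fix i
    have "?b$i - ?a$i = 2 powr (- real n)"
      by (simp add: powr_minus powr_realpow diff_divide_distrib[symmetric] inverse_eq_divide)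
    then show "(?b$i - ?a$i) powr (2 * H$i) = 2 powr (- (2 * real n * H$i))"
      by (simp add: powr_powr mult_ac)
  qed
  also have "\<dots> = 2 powr (\<Sum>i\<in>UNIV. - (2 * real n * H$i))"
    by (simp add: powr_sum)
  also have "(\<Sum>i\<in>UNIV. - (2 * real n * H$i)) = - (2 * real n * (\<Sum>i\<in>UNIV. H$i))"
    by (simp add: sum_negf sum_distrib_left)
  finally show "expectation (\<lambda>\<omega>. (cell_increment (\<lambda>t. W t \<omega>) (\<lambda>_. n) k)\<^sup>2) = 2 powr (- (2 * real n * (\<Sum>i\<in>UNIV. H$i)))" .
qed

text \<open>The union bound over \<open>2\<^sup>n\<^sup>d\<close> cubes costs a factor that is beaten by moments of high order, as the
  standard deviation \<open>2 powr (- n \<Sum>H)\<close> is smaller than the threshold by an exponential factor.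
  By Borel-Cantelli only finitely many generations violate the threshold, and these are absorbed into
  the constant.\<close>

lemma AE_dyadic_increment_bound:
  assumes \<gamma>: "real CARD('n) * \<gamma> < (\<Sum>i\<in>UNIV. H$i)"
  shows "AE \<omega> in M. \<exists>C\<ge>0. \<forall>n. \<forall>k\<in>grid (\<lambda>_. n).
     \<bar>cell_increment (\<lambda>t. W t \<omega>) (\<lambda>_. n) k\<bar> \<le> C * 2 powr (- (real n * real CARD('n) * \<gamma>))"
proof -
  let ?d = "real CARD('n)" and ?h = "\<Sum>i\<in>UNIV. H$i"
  define X where "X n k \<omega> = cell_increment (\<lambda>t. W t \<omega>) (\<lambda>_. n) k" for n k \<omega>
  define l where "l n = 2 powr (- (real n * ?d * \<gamma>))" for n :: nat
  have l: "0 < l n" for n by (simp add: l_def)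
  define \<delta> where "\<delta> = ?h - ?d * \<gamma>"
  have \<delta>: "0 < \<delta>" using \<gamma> by (simp add: \<delta>_def)
  \<comment> \<open>The moment of order \<open>2 m\<close> gains \<open>2 powr (- 2 m \<delta> n)\<close>, which has to beat the \<open>2\<^sup>n\<^sup>d\<close> cubes.\<close>
  obtain m :: nat where m: "?d / (2 * \<delta>) < real m" using reals_Archimedean2 by blast
  define c :: real where "c = fact (2 * m) / (2 ^ m * fact m)"
  define \<rho> where "\<rho> = 2 powr (?d - 2 * real m * \<delta>)"
  have "?d - 2 * real m * \<delta> < 0" using m \<delta> by (simp add: field_simps)
  then have "\<rho> < 2 powr 0" unfolding \<rho>_def by (intro powr_less_mono) auto
  then have \<rho>: "0 < \<rho>" "\<rho> < 1" by (auto simp: \<rho>_def)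
  define A where "A n = (\<Union>k\<in>grid (\<lambda>_. n). {\<omega>\<in>space M. \<bar>X n k \<omega>\<bar> > l n})" for n
  have Xm: "X n k \<in> borel_measurable M" if "k \<in> grid (\<lambda>_. n)" for n k
    using cell_increment_sheet(1)[OF that] by (simp add: gaussian_rv_def X_def[abs_def])
  have ev: "{\<omega>\<in>space M. \<bar>X n k \<omega>\<bar> > l n} \<in> events" if "k \<in> grid (\<lambda>_. n)" for n k
    using Xm[OF that] by measurable
  have A: "A n \<in> events" for n unfolding A_def using ev by (intro sets.finite_UN) auto
  have PA: "prob (A n) \<le> c * \<rho> ^ n" for n
  proof -
    have "prob (A n) \<le> (\<Sum>k\<in>grid (\<lambda>_. n). prob {\<omega>\<in>space M. \<bar>X n k \<omega>\<bar> > l n})"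
      unfolding A_def by (rule finite_measure_subadditive_finite) (use ev in auto)
    also have "\<dots> \<le> (\<Sum>k\<in>grid (\<lambda>_::'n. n). c * (2 powr (- (2 * real n * ?h))) ^ m / l n ^ (2 * m))"
      unfolding c_def X_def by (intro sum_mono gaussian_rv_tail cell_increment_sheet l)
    also have "\<dots> = c * (2 ^ (n * CARD('n)) * (2 powr (- (2 * real n * ?h))) ^ m / l n ^ (2 * m))"
      by (simp add: card_grid)
    also have "2 ^ (n * CARD('n)) * (2 powr (- (2 * real n * ?h))) ^ m / l n ^ (2 * m) = \<rho> ^ n"
    proof -
      have "2 ^ (n * CARD('n)) * (2 powr (- (2 * real n * ?h))) ^ m / l n ^ (2 * m)
        = 2 powr (real n * ?d) * 2 powr (- (2 * real n * ?h) * real m) / 2 powr (- (real n * ?d * \<gamma>) * (2 * real m))"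
        by (simp add: l_def powr_realpow[symmetric] powr_powr)
      also have "\<dots> = 2 powr (real n * ?d + - (2 * real n * ?h) * real m - - (real n * ?d * \<gamma>) * (2 * real m))"
        by (simp only: powr_add powr_diff)
      also have "\<dots> = 2 powr ((?d - 2 * real m * \<delta>) * real n)"
        by (simp add: \<delta>_def algebra_simps)
      also have "\<dots> = \<rho> ^ n" by (simp add: \<rho>_def powr_realpow[symmetric] powr_powr)
      finally show ?thesis .
    qed
    finally show ?thesis .
  qed
  have "summable (\<lambda>n. prob (A n))"
    by (rule summable_comparison_test'[of "\<lambda>n. c * \<rho> ^ n" 0])
       (use PA \<rho> in \<open>auto intro!: summable_mult summable_geometric\<close>)
  then have "AE \<omega> in M. eventually (\<lambda>n. \<omega> \<in> space M - A n) sequentially"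
    by (intro borel_cantelli_AE1 A) (auto simp: less_top[symmetric])
  then show ?thesis
  proof eventually_elim
    case (elim \<omega>)
    then obtain n0 where n0: "\<And>n. n \<ge> n0 \<Longrightarrow> \<omega> \<in> space M - A n" by (auto simp: eventually_sequentially)
    define B where "B n = (\<Sum>k\<in>grid (\<lambda>_. n). \<bar>X n k \<omega>\<bar> / l n)" for n
    have B: "0 \<le> B n" for n unfolding B_def using l[of n] by (intro sum_nonneg) auto
    have B0: "0 \<le> (\<Sum>n<n0. B n)" using B by (intro sum_nonneg) auto
    have "\<bar>X n k \<omega>\<bar> \<le> (1 + (\<Sum>n<n0. B n)) * l n" if k: "k \<in> grid (\<lambda>_. n)" for n k
    proof (cases "n < n0")
      case True
      have "\<bar>X n k \<omega>\<bar> / l n \<le> B n"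
        unfolding B_def by (rule member_le_sum) (use k l[of n] in auto)
      also have "B n \<le> (\<Sum>n<n0. B n)" by (rule member_le_sum) (use True B in auto)
      finally show ?thesis using l[of n] by (simp add: field_simps)
    next
      case False
      then have "\<bar>X n k \<omega>\<bar> \<le> l n" using n0[of n] k by (auto simp: A_def not_less)
      also have "\<dots> \<le> (1 + (\<Sum>n<n0. B n)) * l n" using l[of n] B0 by (simp add: distrib_right)
      finally show ?thesis .
    qed
    then show ?case using B0 by (intro exI[of _ "1 + (\<Sum>n<n0. B n)"]) (auto simp: X_def l_def)
  qed
qed

end

theorem theorem10p3:
  fixes M :: "'w measure" and H :: "real^'n" and W :: "real^'n \<Rightarrow> 'w \<Rightarrow> real"
  assumes "prob_space M"
    and "\<And>i. 0 < H$i \<and> H$i < 1"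
    and "fractional_brownian_sheet M H W"
    and "\<And>\<omega>. \<omega> \<in> space M \<Longrightarrow> (\<lambda>t. W t \<omega>) \<in> C0_cube"
    and "(\<Sum>i\<in>UNIV. H$i) / real CARD('n) > (real CARD('n) - 1) / real CARD('n)"
  shows "AE \<omega> in M. \<forall>\<gamma>. 0 < \<gamma> \<and> \<gamma> < (\<Sum>i\<in>UNIV. H$i) / real CARD('n) \<longrightarrow>
           holder_strongly_chargeable \<gamma> (\<lambda>t. W t \<omega>)"
proof -
  interpret fractional_sheet M H W
    using assms(1,3) by (simp add: fractional_sheet_def fractional_sheet_axioms_def)
  let ?h = "(\<Sum>i\<in>UNIV. H$i) / real CARD('n)"
  have "AE \<omega> in M. \<forall>g\<in>{g\<in>\<rat>. g < ?h}. \<exists>C\<ge>0. \<forall>n. \<forall>k\<in>grid (\<lambda>_. n).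
     \<bar>cell_increment (\<lambda>t. W t \<omega>) (\<lambda>_. n) k\<bar> \<le> C * 2 powr (- (real n * real CARD('n) * g))"
  proof (rule AE_ball_countable')
    fix g assume "g \<in> {g\<in>\<rat>. g < ?h}"
    then have "real CARD('n) * g < (\<Sum>i\<in>UNIV. H$i)" by (simp add: field_simps)
    then show "AE \<omega> in M. \<exists>C\<ge>0. \<forall>n. \<forall>k\<in>grid (\<lambda>_. n).
       \<bar>cell_increment (\<lambda>t. W t \<omega>) (\<lambda>_. n) k\<bar> \<le> C * 2 powr (- (real n * real CARD('n) * g))"
      by (rule AE_dyadic_increment_bound)
  next
    show "countable {g\<in>\<rat>. g < ?h}" by (rule countable_subset[OF _ countable_rat]) auto
  qed
  then show ?thesis
    using AE_space
  proof eventually_elim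
    case (elim \<omega>)
    show ?case
    proof (intro allI impI, elim conjE)
      fix \<gamma> assume \<gamma>: "0 < \<gamma>" "\<gamma> < ?h"
      \<comment> \<open>For small \<open>\<gamma>\<close> the charge is constructed with a larger exponent, above \<open>(d - 1) / d\<close>. Taking it
        rational leaves countably many null sets.\<close>
      have "max \<gamma> ((real CARD('n) - 1) / real CARD('n)) < ?h" using \<gamma>(2) assms(5) by simp
      then obtain g where g: "g \<in> \<rat>" "max \<gamma> ((real CARD('n) - 1) / real CARD('n)) < g" "g < ?h"
        using Rats_dense_in_real by blast
      then obtain C where C: "0 \<le> C" "\<forall>n. \<forall>k\<in>grid (\<lambda>_. n).
         \<bar>cell_increment (\<lambda>t. W t \<omega>) (\<lambda>_. n) k\<bar> \<le> C * 2 powr (- (real n * real CARD('n) * g))"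
        using elim(1) by blast
      show "holder_strongly_chargeable \<gamma> (\<lambda>t. W t \<omega>)"
        by (rule holder_strongly_chargeableI[of _ C g]) (use assms(4)[OF elim(2)] C g in auto)
    qed
  qed
qed

end
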